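(* Let $\tilde G$ be a random cyclic $N$-lift of a bipartite graph $G$ with no parallel edges. For even $c$, let $N_c(\tilde G)$ be the number of cycles of length $c$ in $\tilde G$. For any even $c\ge4$, $$\Big(N-\frac{c^3}{4}\Big)\,T_1\;\le\;E[N_c(\tilde G)]\;\le\;N\,T_1+\frac c4\,T_3,$$ where $T_1=|\mathcal T_1|$ and $T_3=|\mathcal T_3|$. Here $\mathcal T_1$ is the set of prime zero-permutation TBC walks of length $c$ in $G$, $\mathcal T_2$ is the set of TBC walks of length $c$ in $G$ containing at least one zero-permutation TBC subwalk, and $\mathcal T_3$ is the set of all remaining TBC walks of length $c$ in $G$.
   Context: Graphs are finite. Let $G=(U\cup W,E)$ be bipartite. A cyclic $N$-lift of $G$ is determined by permutation shifts $p_e\in\mathbb Z_N$, $e\in E$: each node $v$ is replaced by $N$ copies $v^0,\dots,v^{N-1}$, and each edge $e=\{u,w\}$ ($u\in U$, $w\in W$) by the $N$ edges $\{u^i,w^{i+p_e \bmod N}\}$, $i\in\mathbb Z_N$. In a random cyclic $N$-lift the $p_e$ are independent and uniform on $\mathbb Z_N$. A cycle is counted once, regardless of starting node and direction. A TBC (tailless backtrackless closed) walk of length $c$ is a closed walk with edge sequence $e_1,\dots,e_c$ such that $e_s\ne e_{s+1}$ for $1\le s\le c-1$ and $e_1\ne e_c$. TBC walks differing only in the starting point (cyclic shift) or the direction of travel are identified, and the sets $\mathcal T_i$ consist of the resulting classes. A TBC subwalk of $w$ is a TBC walk formed by a proper, (cyclically) consecutive subsequence of the steps of $w$. A zero-permutation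 (ZP) TBC walk is a TBC walk in which each edge is traversed equally many times in both directions. A prime ZP TBC walk is a ZP TBC walk containing no ZP TBC subwalk. *)

theory Defs
  imports "HOL-Probability.Probability"
begin

text \<open>A graph without parallel edges is given by its set of edges, each edge being the set of
  its two end nodes.\<close>

definition bipartite_graph :: "'a set \<Rightarrow> 'a set \<Rightarrow> 'a set set \<Rightarrow> bool" where
  "bipartite_graph U W E \<longleftrightarrow>
     finite U \<and> finite W \<and> U \<inter> W = {} \<and> E \<subseteq> {{u, w} |u w. u \<in> U \<and> w \<in> W}"

text \<open>A closed walk of length \<open>c\<close> is represented by the list of its nodes
  \<open>[v\<^sub>0, \<dots>, v\<^sub>c\<^sub>-\<^sub>1]\<close> without repeating \<open>v\<^sub>0\<close> at the end, so its steps are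
  \<open>(v\<^sub>0, v\<^sub>1), \<dots>, (v\<^sub>c\<^sub>-\<^sub>1, v\<^sub>0)\<close>; as there are no parallel edges, the nodes determine
  the edges.\<close>

definition steps :: "'a list \<Rightarrow> ('a \<times> 'a) list" where
  "steps xs = zip xs (rotate1 xs)"

definition edge_seq :: "'a list \<Rightarrow> 'a set list" where
  "edge_seq xs = map (\<lambda>(u, v). {u, v}) (steps xs)"

definition closed_walk :: "'a set set \<Rightarrow> 'a list \<Rightarrow> bool" where
  "closed_walk E xs \<longleftrightarrow> xs \<noteq> [] \<and> set (edge_seq xs) \<subseteq> E"

text \<open>Closed walks that differ only in starting point and direction of travel.\<close>

definition walk_equiv :: "('a list \<times> 'a list) set" where
  "walk_equiv = {(xs, ys). \<exists>k. ys = rotate k xs \<or> ys = rotate k (rev xs)}"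

definition is_cycle :: "'a set set \<Rightarrow> 'a list \<Rightarrow> bool" where
  "is_cycle E xs \<longleftrightarrow> closed_walk E xs \<and> 3 \<le> length xs \<and> distinct xs"

definition num_cycles :: "nat \<Rightarrow> 'a set set \<Rightarrow> nat" where
  "num_cycles c E = card ({xs. is_cycle E xs \<and> length xs = c} // walk_equiv)"

definition tbc_walk :: "'a set set \<Rightarrow> 'a list \<Rightarrow> bool" where
  "tbc_walk E xs \<longleftrightarrow> closed_walk E xs \<and>
     distinct_adj (edge_seq xs) \<and> hd (edge_seq xs) \<noteq> last (edge_seq xs)"

definition tbc_subwalk :: "'a set set \<Rightarrow> 'a list \<Rightarrow> 'a list \<Rightarrow> bool" where
  "tbc_subwalk E ys xs \<longleftrightarrow> tbc_walk E ys \<and>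
     (\<exists>k rest. rest \<noteq> [] \<and> rotate k (steps xs) = steps ys @ rest)"

definition zp_tbc_walk :: "'a set set \<Rightarrow> 'a list \<Rightarrow> bool" where
  "zp_tbc_walk E xs \<longleftrightarrow> tbc_walk E xs \<and>
     (\<forall>u v. count_list (steps xs) (u, v) = count_list (steps xs) (v, u))"

definition has_zp_tbc_subwalk :: "'a set set \<Rightarrow> 'a list \<Rightarrow> bool" where
  "has_zp_tbc_subwalk E xs \<longleftrightarrow> (\<exists>ys. tbc_subwalk E ys xs \<and> zp_tbc_walk E ys)"

definition prime_zp_tbc_walk :: "'a set set \<Rightarrow> 'a list \<Rightarrow> bool" where
  "prime_zp_tbc_walk E xs \<longleftrightarrow> zp_tbc_walk E xs \<and> \<not> has_zp_tbc_subwalk E xs"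

definition tbc_classes :: "nat \<Rightarrow> 'a set set \<Rightarrow> 'a list set set" where
  "tbc_classes c E = {xs. tbc_walk E xs \<and> length xs = c} // walk_equiv"

definition T1_set :: "nat \<Rightarrow> 'a set set \<Rightarrow> 'a list set set" where
  "T1_set c E = {xs. prime_zp_tbc_walk E xs \<and> length xs = c} // walk_equiv"

definition T2_set :: "nat \<Rightarrow> 'a set set \<Rightarrow> 'a list set set" where
  "T2_set c E = {xs. tbc_walk E xs \<and> has_zp_tbc_subwalk E xs \<and> length xs = c} // walk_equiv"

definition T3_set :: "nat \<Rightarrow> 'a set set \<Rightarrow> 'a list set set" where
  "T3_set c E = tbc_classes c E - (T1_set c E \<union> T2_set c E)"

text \<open>The \<open>i\<close>-th copy of a node \<open>v\<close> is \<open>(v, i)\<close>, and the integers modulo \<open>N\<close> are represented by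
  the residues below \<open>N\<close>.\<close>

definition cyclic_lift ::
  "nat \<Rightarrow> 'a set \<Rightarrow> 'a set \<Rightarrow> 'a set set \<Rightarrow> ('a set \<Rightarrow> nat) \<Rightarrow> ('a \<times> nat) set set" where
  "cyclic_lift N U W E p =
     {{(u, i), (w, (i + p {u, w}) mod N)} |u w i. u \<in> U \<and> w \<in> W \<and> {u, w} \<in> E \<and> i < N}"

text \<open>The shifts of the edges are independent and uniform; outside of \<open>E\<close> they are irrelevant
  and set to 0.\<close>

definition random_cyclic_lift ::
  "nat \<Rightarrow> 'a set \<Rightarrow> 'a set \<Rightarrow> 'a set set \<Rightarrow> ('a \<times> nat) set set pmf" where
  "random_cyclic_lift N U W E =
     map_pmf (cyclic_lift N U W E) (Pi_pmf E 0 (\<lambda>_. pmf_of_set {..<N}))"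

lemma bipartite_graph_cyclic_lift:
  assumes "bipartite_graph U W E" "0 < N"
  shows "bipartite_graph (U \<times> {..<N}) (W \<times> {..<N}) (cyclic_lift N U W E p)"
proof -
  have "cyclic_lift N U W E p \<subseteq> {{x, y} |x y. x \<in> U \<times> {..<N} \<and> y \<in> W \<times> {..<N}}"
  proof
    fix e assume "e \<in> cyclic_lift N U W E p"
    then obtain u w i where e: "e = {(u, i), (w, (i + p {u, w}) mod N)}" "u \<in> U" "w \<in> W" "i < N"
      unfolding cyclic_lift_def by blast
    have "(i + p {u, w}) mod N < N" using assms(2) by simp
    with e(2-4) have "(u, i) \<in> U \<times> {..<N}" "(w, (i + p {u, w}) mod N) \<in> W \<times> {..<N}" by simp_all
    with e(1) show "e \<in> {{x, y} |x y. x \<in> U \<times> {..<N} \<and> y \<in> W \<times> {..<N}}" by blast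
  qed
  moreover have "(U \<times> {..<N}) \<inter> (W \<times> {..<N}) = {}"
    using assms(1) unfolding bipartite_graph_def by blast
  ultimately show ?thesis
    using assms(1) unfolding bipartite_graph_def by simp
qed

lemma equiv_walk_equiv: "equiv UNIV (walk_equiv :: ('a list \<times> 'a list) set)"
proof (rule equivI)
  have inv: "\<exists>j. xs = rotate j (rotate k xs)" for k and xs :: "'a list"
  proof (cases "xs = []")
    case False
    then have "k mod length xs < length xs" by simp
    then have "rotate (length xs - k mod length xs) (rotate (k mod length xs) xs) = xs"
      by (simp add: rotate_rotate)
    then show ?thesis by (metis rotate_conv_mod)
  qed simp
  have rev_rot: "\<exists>j. rev (rotate k xs) = rotate j (rev xs)" for k and xs :: "'a list"
    by (metis rotate_rev rev_rev_ident)
  show "refl_on UNIV (walk_equiv :: ('a list \<times> 'a list) set)"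
    by (auto simp: refl_on_def walk_equiv_def intro: exI[of _ 0])
  show "sym (walk_equiv :: ('a list \<times> 'a list) set)"
  proof (rule symI)
    fix xs ys :: "'a list"
    assume "(xs, ys) \<in> walk_equiv"
    then obtain k where "ys = rotate k xs \<or> ys = rotate k (rev xs)"
      by (auto simp: walk_equiv_def)
    then show "(ys, xs) \<in> walk_equiv"
    proof
      assume "ys = rotate k xs"
      then show ?thesis using inv[of xs k] by (auto simp: walk_equiv_def)
    next
      assume ys: "ys = rotate k (rev xs)"
      obtain j where "rev ys = rotate j xs"
        using rev_rot[of k "rev xs"] ys by auto
      then show ?thesis using inv[of xs j] by (auto simp: walk_equiv_def)
    qed
  qed
  show "trans (walk_equiv :: ('a list \<times> 'a list) set)"
  proof (rule transI)
    fix xs ys zs :: "'a list"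
    assume "(xs, ys) \<in> walk_equiv" "(ys, zs) \<in> walk_equiv"
    then obtain k l where y: "ys = rotate k xs \<or> ys = rotate k (rev xs)"
      and z: "zs = rotate l ys \<or> zs = rotate l (rev ys)"
      by (auto simp: walk_equiv_def)
    have "\<exists>j. rev ys = rotate j xs \<or> rev ys = rotate j (rev xs)"
      using y rev_rot[of k xs] rev_rot[of k "rev xs"] by auto
    then obtain j where "rev ys = rotate j xs \<or> rev ys = rotate j (rev xs)" by blast
    with y z show "(xs, zs) \<in> walk_equiv"
      by (auto simp: walk_equiv_def rotate_rotate)
  qed
qed simp

end

theory Submission
  imports Defs
begin

text \<open>A cycle of the lift projects to a TBC walk of the base graph, and a TBC walk is such a
  projection iff its total shift vanishes modulo \<open>N\<close> while the shift of every proper closed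
  segment does not; it then lifts to \<open>N\<close> node sequences. Cycles, and prime ZP walks, have no
  rotational or reflectional symmetry, so their classes consist of exactly \<open>2 * c\<close> node sequences
  and all counting can be done with sequences. For a list of steps which is not balanced, some edge
  has a nonzero net coefficient \<open>a\<close>, so its shift vanishes with probability at most \<open>\<bar>a\<bar> / N\<close>, and
  \<open>\<bar>a\<bar> \<le> c / 4\<close> since a bipartite TBC walk makes a given step at most every fourth time. This is
  the bound for the third set of walks, and the union bound over fewer than \<open>c\<^sup>2\<close> closed segments
  of a prime ZP walk, none of which is balanced, gives \<open>c\<^sup>3 / 4\<close>.\<close>

section \<open>Closed walks up to rotation and reversal\<close>

lemma length_steps [simp]: "length (steps xs) = length xs"
  by (simp add: steps_def)

lemma nth_steps: "i < length xs \<Longrightarrow> steps xs ! i = (xs ! i, xs ! (Suc i mod length xs))"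
  by (simp add: steps_def nth_rotate1)

lemma steps_eq_Nil_iff [simp]: "steps xs = [] \<longleftrightarrow> xs = []"
  by (metis length_0_conv length_steps)

lemma map_fst_steps [simp]: "map fst (steps xs) = xs"
  by (simp add: steps_def)

lemma steps_rotate: "steps (rotate k xs) = rotate k (steps xs)"
proof (rule nth_equalityI)
  fix i assume "i < length (steps (rotate k xs))"
  then have i: "i < length xs" by simp
  then have "0 < length xs" by linarith
  with i show "steps (rotate k xs) ! i = rotate k (steps xs) ! i"
    by (simp add: nth_steps nth_rotate mod_simps)
qed simp

text \<open>Reversing the swapped steps puts the inverse of the closing step first, whereas the
  reversed walk makes it last; hence the rotation by one.\<close>

lemma steps_rev: "steps (rev xs) = rotate1 (rev (map prod.swap (steps xs)))"
proof (rule nth_equalityI)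
  fix i assume "i < length (steps (rev xs))"
  then have i: "i < length xs" by simp
  show "steps (rev xs) ! i = rotate1 (rev (map prod.swap (steps xs))) ! i"
  proof (cases "Suc i < length xs")
    case True
    then have "Suc (length xs - Suc (Suc i)) = length xs - Suc i" by linarith
    with True show ?thesis by (simp add: nth_steps nth_rotate1 rev_nth)
  next
    case False
    with i have "length xs = Suc i" by linarith
    then show ?thesis by (simp add: nth_steps nth_rotate1 rev_nth)
  qed
qed simp

lemma count_list_rotate [simp]: "count_list (rotate k xs) x = count_list xs x"
  by (simp add: rotate_drop_take flip: count_list_append)
     (metis append_take_drop_id count_list_append add.commute)

lemma count_steps_rotate [simp]: "count_list (steps (rotate k xs)) s = count_list (steps xs) s"
  by (simp add: steps_rotate)

lemma count_steps_rev [simp]: "count_list (steps (rev xs)) (u, v) = count_list (steps xs) (v, u)"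
proof -
  have "count_list (map prod.swap (steps xs)) (prod.swap (v, u)) = count_list (steps xs) (v, u)"
    by (rule count_list_map_conv) simp
  moreover have "count_list (rotate1 ys) x = count_list ys x" for x and ys :: "('a \<times> 'a) list"
    using count_list_rotate[of 1] by simp
  ultimately show ?thesis by (simp add: steps_rev)
qed

section \<open>Tailless edge sequences without backtracking\<close>

definition nonback :: "'a list \<Rightarrow> bool" where
  "nonback es \<longleftrightarrow> distinct_adj es \<and> hd es \<noteq> last es"

lemma nonback_rotate1: "es \<noteq> [] \<Longrightarrow> nonback (rotate1 es) \<longleftrightarrow> nonback es"
  by (cases es) (auto simp: nonback_def distinct_adj_append_iff distinct_adj_Cons)

lemma nonback_rotate: "es \<noteq> [] \<Longrightarrow> nonback (rotate k es) \<longleftrightarrow> nonback es"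
  by (induction k) (simp_all add: nonback_rotate1)

lemma nonback_rev: "es \<noteq> [] \<Longrightarrow> nonback (rev es) \<longleftrightarrow> nonback es"
  by (auto simp: nonback_def hd_rev last_rev)

lemma edge_seq_rotate: "edge_seq (rotate k xs) = rotate k (edge_seq xs)"
  by (simp add: edge_seq_def steps_rotate rotate_map)

lemma edge_seq_rev: "edge_seq (rev xs) = rotate 1 (rev (edge_seq xs))"
  by (simp add: edge_seq_def steps_rev rotate1_map rev_map case_prod_beta insert_commute
      flip: map_map) (simp add: comp_def insert_commute)

lemma edge_seq_eq_Nil_iff [simp]: "edge_seq xs = [] \<longleftrightarrow> xs = []"
  by (simp add: edge_seq_def)

lemma closed_walk_rotate [simp]: "closed_walk E (rotate k xs) \<longleftrightarrow> closed_walk E xs"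
  by (simp add: closed_walk_def edge_seq_rotate)

lemma closed_walk_rev [simp]: "closed_walk E (rev xs) \<longleftrightarrow> closed_walk E xs"
  by (simp add: closed_walk_def edge_seq_rev)

lemma tbc_walk_nonback: "tbc_walk E xs \<longleftrightarrow> closed_walk E xs \<and> nonback (edge_seq xs)"
  by (auto simp: tbc_walk_def nonback_def)

lemma tbc_walk_rotate [simp]: "tbc_walk E (rotate k xs) \<longleftrightarrow> tbc_walk E xs"
  by (cases "xs = []") (simp_all add: tbc_walk_nonback edge_seq_rotate nonback_rotate)

lemma tbc_walk_rev [simp]: "tbc_walk E (rev xs) \<longleftrightarrow> tbc_walk E xs"
  by (cases "xs = []")
     (simp_all only: tbc_walk_nonback edge_seq_rev nonback_rotate nonback_rev closed_walk_rev
       rev_is_Nil_conv edge_seq_eq_Nil_iff rev.simps simp_thms)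

lemma zp_tbc_walk_rotate [simp]: "zp_tbc_walk E (rotate k xs) \<longleftrightarrow> zp_tbc_walk E xs"
  by (simp add: zp_tbc_walk_def)

lemma zp_tbc_walk_rev [simp]: "zp_tbc_walk E (rev xs) \<longleftrightarrow> zp_tbc_walk E xs"
  by (auto simp: zp_tbc_walk_def)

lemma rotate_inverse:
  obtains j where "rotate j (rotate k xs) = xs"
proof (cases "xs = []")
  case True
  then show ?thesis using that[of 0] by simp
next
  case False
  then have "k mod length xs < length xs" by simp
  then have "rotate (length xs - k mod length xs) (rotate (k mod length xs) xs) = xs"
    by (simp add: rotate_rotate)
  then show ?thesis using that by (metis rotate_conv_mod)
qed

lemma rev_rotate: "\<exists>j. rev (rotate k xs) = rotate j (rev xs)"
  by (metis rotate_rev rev_rev_ident)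

section \<open>Symmetry of the subwalk condition\<close>

lemma has_zp_tbc_subwalk_rotateI:
  assumes "has_zp_tbc_subwalk E xs"
  shows "has_zp_tbc_subwalk E (rotate k xs)"
proof -
  obtain ys l rest where ys: "zp_tbc_walk E ys" "rest \<noteq> []"
    "rotate l (steps xs) = steps ys @ rest"
    using assms by (auto simp: has_zp_tbc_subwalk_def tbc_subwalk_def)
  obtain j where "rotate j (rotate k xs) = xs" by (rule rotate_inverse)
  then have "rotate l (steps (rotate j (rotate k xs))) = steps ys @ rest"
    using ys(3) by simp
  then have "rotate (l + j) (steps (rotate k xs)) = steps ys @ rest"
    by (simp only: steps_rotate rotate_rotate add.assoc)
  with ys(1,2) show ?thesis
    unfolding has_zp_tbc_subwalk_def tbc_subwalk_def zp_tbc_walk_def by blast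
qed

text \<open>Travelled backwards, the subwalk and its complement appear in the opposite order;
  rotating past the complement brings the reversed subwalk to the front. The other rotations make up
  for the offset by one in \<open>steps_rev\<close>.\<close>

lemma has_zp_tbc_subwalk_revI:
  assumes "has_zp_tbc_subwalk E xs"
  shows "has_zp_tbc_subwalk E (rev xs)"
proof -
  obtain ys l rest where ys: "zp_tbc_walk E ys" "rest \<noteq> []"
    "rotate l (steps xs) = steps ys @ rest"
    using assms by (auto simp: has_zp_tbc_subwalk_def tbc_subwalk_def)
  define bw where "bw = (\<lambda>ss :: ('a \<times> 'a) list. rev (map prod.swap ss))"
  have steps_rev': "steps (rev zs) = rotate 1 (bw (steps zs))" for zs
    by (simp add: steps_rev bw_def)
  \<comment> \<open>\<open>rev ys\<close> starts one step too late for its steps to be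
    \<open>bw (steps ys)\<close>, so a rotation of it is the witness.\<close>
  obtain i where "rotate i (rotate 1 (bw (steps ys))) = bw (steps ys)"
    by (rule rotate_inverse)
  then have fwd: "steps (rotate i (rev ys)) = bw (steps ys)"
    by (simp add: steps_rotate steps_rev')
  obtain l' where "bw (rotate l (steps xs)) = rotate l' (bw (steps xs))"
    using rev_rotate[of l "map prod.swap (steps xs)"] by (auto simp: bw_def rotate_map)
  moreover have "bw (rotate l (steps xs)) = bw rest @ bw (steps ys)"
    by (simp add: ys(3) bw_def)
  ultimately have "rotate (length (bw rest)) (rotate l' (bw (steps xs))) = bw (steps ys) @ bw rest"
    using rotate_append[of "bw rest" "bw (steps ys)"] by simp
  moreover obtain j where "rotate j (rotate 1 (bw (steps xs))) = bw (steps xs)"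
    by (rule rotate_inverse)
  ultimately have
    "rotate (length (bw rest)) (rotate l' (rotate j (steps (rev xs)))) = bw (steps ys) @ bw rest"
    by (simp only: steps_rev')
  then have "rotate (length (bw rest) + (l' + j)) (steps (rev xs)) = bw (steps ys) @ bw rest"
    by (simp only: rotate_rotate add.assoc)
  moreover have "bw rest \<noteq> []" using ys(2) by (simp add: bw_def)
  moreover have "zp_tbc_walk E (rotate i (rev ys))" using ys(1) by simp
  ultimately show ?thesis
    unfolding has_zp_tbc_subwalk_def tbc_subwalk_def zp_tbc_walk_def fwd[symmetric] by blast
qed

lemma has_zp_tbc_subwalk_rotate [simp]:
  "has_zp_tbc_subwalk E (rotate k xs) \<longleftrightarrow> has_zp_tbc_subwalk E xs"
proof
  obtain j where "rotate j (rotate k xs) = xs" by (rule rotate_inverse)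
  then show "has_zp_tbc_subwalk E xs" if "has_zp_tbc_subwalk E (rotate k xs)"
    using has_zp_tbc_subwalk_rotateI[OF that, of j] by simp
qed (rule has_zp_tbc_subwalk_rotateI)

lemma has_zp_tbc_subwalk_rev [simp]: "has_zp_tbc_subwalk E (rev xs) \<longleftrightarrow> has_zp_tbc_subwalk E xs"
  by (metis has_zp_tbc_subwalk_revI rev_rev_ident)

lemma prime_zp_tbc_walk_rotate [simp]:
  "prime_zp_tbc_walk E (rotate k xs) \<longleftrightarrow> prime_zp_tbc_walk E xs"
  by (simp add: prime_zp_tbc_walk_def)

lemma prime_zp_tbc_walk_rev [simp]: "prime_zp_tbc_walk E (rev xs) \<longleftrightarrow> prime_zp_tbc_walk E xs"
  by (simp add: prime_zp_tbc_walk_def)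

section \<open>Sizes of equivalence classes\<close>

lemma walk_class_eq:
  assumes "xs \<noteq> []"
  shows "walk_equiv `` {xs} =
    (\<lambda>k. rotate k xs) ` {..<length xs} \<union> (\<lambda>k. rotate k (rev xs)) ` {..<length xs}"
proof -
  have "\<exists>l\<in>{..<length xs}. rotate k zs = rotate l zs" if "length zs = length xs" for k and zs :: "'a list"
    using that assms rotate_conv_mod[of k zs] by (intro bexI[of _ "k mod length xs"]) simp_all
  from this[of xs] this[of "rev xs"] show ?thesis
    unfolding walk_equiv_def by (auto simp: image_iff)
qed

lemma card_walk_class_le:
  assumes "xs \<noteq> []"
  shows "card (walk_equiv `` {xs}) \<le> 2 * length xs"
proof -
  have "card (walk_equiv `` {xs}) \<le> card ((\<lambda>k. rotate k xs) ` {..<length xs}) +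
      card ((\<lambda>k. rotate k (rev xs)) ` {..<length xs})"
    unfolding walk_class_eq[OF assms] by (rule card_Un_le)
  also have "\<dots> \<le> length xs + length xs"
    by (intro add_mono) (metis card_image_le card_lessThan finite_lessThan)+
  finally show ?thesis by simp
qed

lemma inj_on_rotate:
  assumes "\<And>k. 0 < k \<Longrightarrow> k < length xs \<Longrightarrow> rotate k xs \<noteq> xs"
  shows "inj_on (\<lambda>k. rotate k xs) {..<length xs}"
proof (rule linorder_inj_onI')
  fix k l assume kl: "k \<in> {..<length xs}" "l \<in> {..<length xs}" "k < l"
  show "rotate k xs \<noteq> rotate l xs"
  proof
    assume eq: "rotate k xs = rotate l xs"
    have "rotate (length xs - k) (rotate k xs) = xs"
      using kl by (simp add: rotate_rotate)
    moreover have "rotate (length xs - k) (rotate l xs) = rotate (l - k) xs"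
    proof -
      have "length xs - k + l = length xs + (l - k)" using kl by simp
      then have "(length xs - k + l) mod length xs = (l - k) mod length xs"
        by (metis mod_add_self1)
      then show ?thesis by (metis rotate_rotate rotate_conv_mod)
    qed
    moreover have "0 < l - k" "l - k < length xs" using kl by auto
    ultimately show False using eq assms[of "l - k"] by simp
  qed
qed

text \<open>\<open>rot\<close> makes the rotations of \<open>xs\<close>, and those of its reverse,
  pairwise distinct; \<open>refl\<close> keeps the two families apart.\<close>

lemma card_walk_class:
  assumes "xs \<noteq> []"
    and rot: "\<And>k. 0 < k \<Longrightarrow> k < length xs \<Longrightarrow> rotate k xs \<noteq> xs"
    and refl: "\<And>k. rotate k (rev xs) \<noteq> xs"
  shows "card (walk_equiv `` {xs}) = 2 * length xs"
proof -
  \<comment> \<open>A symmetry of the reverse under rotation by \<open>k\<close> is one of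
    \<open>xs\<close> under rotation by \<open>length xs - k\<close>.\<close>
  have "rotate k (rev xs) \<noteq> rev xs" if k: "0 < k" "k < length xs" for k
  proof
    assume "rotate k (rev xs) = rev xs"
    then have "rotate (length xs - k) xs = xs"
      using k by (simp add: rotate_rev)
    moreover have "0 < length xs - k" "length xs - k < length xs" using k by auto
    ultimately show False using rot[of "length xs - k"] by blast
  qed
  then have "inj_on (\<lambda>k. rotate k (rev xs)) {..<length xs}"
    using inj_on_rotate[of "rev xs"] by simp
  moreover have "inj_on (\<lambda>k. rotate k xs) {..<length xs}"
    using inj_on_rotate[OF rot] .
  moreover have "rotate k xs \<noteq> rotate l (rev xs)" for k l
  proof
    assume "rotate k xs = rotate l (rev xs)"
    moreover obtain j where "rotate j (rotate k xs) = xs" by (rule rotate_inverse)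
    ultimately have "rotate j (rotate l (rev xs)) = xs" by (simp only:)
    then have "rotate (j + l) (rev xs) = xs" by (simp only: rotate_rotate)
    with refl show False by blast
  qed
  then have "(\<lambda>k. rotate k xs) ` {..<length xs} \<inter> (\<lambda>k. rotate k (rev xs)) ` {..<length xs} = {}"
    by blast
  ultimately show ?thesis
    unfolding walk_class_eq[OF assms(1)]
    by (simp add: card_Un_disjoint card_image)
qed

lemma walk_class_induct:
  assumes "(xs, ys) \<in> walk_equiv" "P xs" "\<And>k zs. P zs \<Longrightarrow> P (rotate k zs)" "\<And>zs. P zs \<Longrightarrow> P (rev zs)"
  shows "P ys"
  using assms by (auto simp: walk_equiv_def)

lemma Union_walk_classes:
  assumes "\<And>k zs. zs \<in> A \<Longrightarrow> rotate k zs \<in> A" "\<And>zs. zs \<in> A \<Longrightarrow> rev zs \<in> A"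
  shows "\<Union>(A // walk_equiv) = A"
proof
  show "\<Union>(A // walk_equiv) \<subseteq> A"
  proof
    fix ys assume "ys \<in> \<Union>(A // walk_equiv)"
    then obtain xs where "xs \<in> A" "(xs, ys) \<in> walk_equiv"
      by (auto simp: quotient_def)
    then show "ys \<in> A"
      using walk_class_induct[of xs ys "\<lambda>zs. zs \<in> A"] assms by blast
  qed
  show "A \<subseteq> \<Union>(A // walk_equiv)"
    using equiv_class_self[OF equiv_walk_equiv] by (fastforce simp: quotient_def)
qed

text \<open>Walks may have a rotational symmetry here, for example a cycle traversed several times,
  and then their classes are smaller than \<open>2 * c\<close>.\<close>

lemma card_le_walk_classes:
  assumes "finite A" "\<And>k zs. zs \<in> A \<Longrightarrow> rotate k zs \<in> A" "\<And>zs. zs \<in> A \<Longrightarrow> rev zs \<in> A"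
    and "\<And>xs. xs \<in> A \<Longrightarrow> length xs = c" "0 < c"
  shows "card A \<le> 2 * c * card (A // walk_equiv)"
proof -
  have "card A = card (\<Union>(A // walk_equiv))"
    using assms(2,3) by (simp add: Union_walk_classes)
  also have "\<dots> \<le> (\<Sum>C\<in>A // walk_equiv. card C)"
    by (rule card_Union_le_sum_card)
  also have "\<dots> \<le> (\<Sum>C\<in>A // walk_equiv. 2 * c)"
  proof (rule sum_mono)
    fix C assume "C \<in> A // walk_equiv"
    then obtain xs where "xs \<in> A" "C = walk_equiv `` {xs}"
      by (auto simp: quotient_def)
    with assms(4)[of xs] assms(5) have "length xs = c" "xs \<noteq> []" by auto
    with card_walk_class_le[of xs] \<open>C = _\<close> show "card C \<le> 2 * c"
      by simp
  qed
  finally show ?thesis by (simp add: mult.commute)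
qed

lemma card_eq_walk_classes:
  assumes "finite A" "\<And>k zs. zs \<in> A \<Longrightarrow> rotate k zs \<in> A" "\<And>zs. zs \<in> A \<Longrightarrow> rev zs \<in> A"
    and "\<And>xs. xs \<in> A \<Longrightarrow> card (walk_equiv `` {xs}) = m"
  shows "card A = m * card (A // walk_equiv)"
proof -
  have U: "\<Union>(A // walk_equiv) = A"
    using assms(2,3) by (simp add: Union_walk_classes)
  have "m * card (A // walk_equiv) = card (\<Union>(A // walk_equiv))"
  proof (rule card_partition)
    show "finite (A // walk_equiv)"
      using assms(1) by (simp add: quotient_def)
    show "C \<inter> D = {}" if "C \<in> A // walk_equiv" "D \<in> A // walk_equiv" "C \<noteq> D" for C D
      using quotient_disj[OF equiv_walk_equiv, of C D] that by (auto simp: quotient_def)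
  qed (use assms(1,4) U in \<open>auto simp: quotient_def\<close>)
  with U show ?thesis by simp
qed

text \<open>A coincidence with a rotated reverse is a reflection of the circle of indices. Its axis
  passes through a position, whose two neighbours then carry the same node, or between two adjacent
  positions, which then carry the same node.\<close>

lemma reversal_neq_rotate:
  assumes "2 \<le> length xs"
    and loop: "\<And>i. i < length xs \<Longrightarrow> xs ! i \<noteq> xs ! (Suc i mod length xs)"
    and backtrack: "\<And>i. i < length xs \<Longrightarrow> xs ! i \<noteq> xs ! (Suc (Suc i) mod length xs)"
  shows "rotate k (rev xs) \<noteq> xs"
proof
  define c where "c = length xs"
  assume eq0: "rotate k (rev xs) = xs"
  have c: "2 \<le> c" using assms(1) by (simp add: c_def)
  define l where "l = k mod c"
  have l: "l < c" using c by (simp add: l_def)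
  have eq: "rotate l (rev xs) = xs"
    using eq0 by (simp add: l_def c_def rotate_conv_mod[of k])
  \<comment> \<open>The reflection sends \<open>i\<close> to \<open>M - i\<close> modulo
    \<open>c\<close>. Starting from \<open>2 * c\<close> keeps \<open>M - i\<close> positive for
    every \<open>i < c\<close>, so the subtraction is never truncated.\<close>
  define M where "M = 2 * c - 1 - l"
  have refl: "xs ! i = xs ! ((M - i) mod c)" if i: "i < c" for i
  proof -
    have "xs ! i = rev xs ! ((l + i) mod c)"
      using nth_rotate[of i "rev xs" l] i eq by (simp add: c_def)
    also have "\<dots> = xs ! (c - 1 - (l + i) mod c)"
      using c by (simp add: rev_nth flip: c_def)
    also have "c - 1 - (l + i) mod c = (M - i) mod c"
    proof (cases "l + i < c")
      case True
      then have "M - i = c - 1 - (l + i) + c" using l i by (simp add: M_def)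
      then have "(M - i) mod c = (c - 1 - (l + i)) mod c" by (simp only: mod_add_self2)
      then show ?thesis using True c by simp
    next
      case False
      then have "(l + i) mod c = l + i - c" "M - i = c - 1 - (l + i - c)" "M - i < c"
        using l i by (simp_all add: M_def mod_if)
      then show ?thesis by simp
    qed
    finally show ?thesis .
  qed
  \<comment> \<open>From c \<le> \<open>M\<close> < 2c, the index \<open>t\<close> is in range. It
    is fixed by the reflection if \<open>M\<close> is even, and exchanged with its successor if
    \<open>M\<close> is odd.\<close>
  define t where "t = M div 2"
  have t: "1 \<le> t" "t < c" using l c by (simp_all add: t_def M_def)
  show False
  proof (cases "even M")
    case True
    then have "M - (t - 1) = Suc (Suc (t - 1))" using t by (auto simp: t_def)
    moreover have "t - 1 < c" using t by simp
    ultimately show False using refl[of "t - 1"] backtrack[of "t - 1"] t by (simp add: c_def)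
  next
    case False
    then have "M - t = Suc t" by (auto simp: t_def elim: oddE)
    with refl[of t] loop[of t] t show False by (simp add: c_def)
  qed
qed

section \<open>Tailless backtrackless walks in bipartite graphs\<close>

lemma nth_edge_seq:
  "i < length xs \<Longrightarrow> edge_seq xs ! i = {xs ! i, xs ! (Suc i mod length xs)}"
  by (simp add: edge_seq_def nth_steps)

lemma closed_walk_iff:
  "closed_walk E xs \<longleftrightarrow>
     xs \<noteq> [] \<and> (\<forall>i<length xs. {xs ! i, xs ! (Suc i mod length xs)} \<in> E)"
  by (auto simp: closed_walk_def set_conv_nth nth_edge_seq) (auto simp: edge_seq_def nth_steps)

lemma nonback_iff:
  assumes "es \<noteq> []"
  shows "nonback es \<longleftrightarrow> (\<forall>i<length es. es ! i \<noteq> es ! (Suc i mod length es))"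
proof
  assume nb: "nonback es"
  show "\<forall>i<length es. es ! i \<noteq> es ! (Suc i mod length es)"
  proof (intro allI impI)
    fix i assume i: "i < length es"
    show "es ! i \<noteq> es ! (Suc i mod length es)"
    proof (cases "Suc i < length es")
      case True
      with nb show ?thesis by (simp add: nonback_def distinct_adj_nth)
    next
      case False
      with i have "length es = Suc i" by simp
      with nb assms show ?thesis by (auto simp: nonback_def hd_conv_nth last_conv_nth)
    qed
  qed
next
  assume *: "\<forall>i<length es. es ! i \<noteq> es ! (Suc i mod length es)"
  have "distinct_adj es"
    unfolding distinct_adj_conv_nth
  proof (intro allI impI)
    fix i assume "Suc i < length es"
    with *[rule_format, of i] show "es ! i \<noteq> es ! Suc i" by simp
  qed
  moreover have "hd es \<noteq> last es"
    using *[rule_format, of "length es - 1"] assms by (simp add: hd_conv_nth last_conv_nth)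
  ultimately show "nonback es" by (simp add: nonback_def)
qed

text \<open>Consecutive edges share their middle node, so without loops they coincide exactly when
  their outer nodes do. This replaces a condition on edges by one on nodes at distance two.\<close>

lemma tbc_walk_iff:
  assumes loopless: "\<And>a. {a} \<notin> E"
  shows "tbc_walk E xs \<longleftrightarrow> xs \<noteq> [] \<and>
    (\<forall>i<length xs. {xs ! i, xs ! (Suc i mod length xs)} \<in> E \<and>
       xs ! i \<noteq> xs ! (Suc (Suc i) mod length xs))"
proof (cases "closed_walk E xs")
  case False
  then show ?thesis by (auto simp: tbc_walk_nonback closed_walk_iff)
next
  case True
  then have edges: "{xs ! i, xs ! (Suc i mod length xs)} \<in> E"
    if "i < length xs" for i
    using that by (auto simp: closed_walk_iff)
  have "edge_seq xs ! i \<noteq> edge_seq xs ! (Suc i mod length xs) \<longleftrightarrow>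
      xs ! i \<noteq> xs ! (Suc (Suc i) mod length xs)" if i: "i < length xs" for i
  proof -
    define j where "j = Suc i mod length xs"
    from i have "0 < length xs" by linarith
    then have j: "j < length xs" by (simp add: j_def)
    have "Suc j mod length xs = Suc (Suc i) mod length xs"
      by (simp add: j_def mod_Suc_eq)
    moreover have "xs ! i \<noteq> xs ! j"
      using edges[OF i] loopless by (metis insert_absorb2 j_def)
    ultimately show ?thesis
      using i j nth_edge_seq[OF i] nth_edge_seq[OF j] by (auto simp: doubleton_eq_iff j_def)
  qed
  with True show ?thesis
    by (cases "xs = []") (auto simp: tbc_walk_nonback nonback_iff closed_walk_iff edge_seq_def)
qed

section \<open>Balanced step lists and closed segments\<close>

definition balanced :: "('a \<times> 'a) list \<Rightarrow> bool" where
  "balanced ss \<longleftrightarrow> (\<forall>u v. count_list ss (u, v) = count_list ss (v, u))"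

lemma balancedD: "balanced ss \<Longrightarrow> count_list ss (u, v) = count_list ss (v, u)"
  by (simp add: balanced_def)

lemma zp_tbc_walk_balanced: "zp_tbc_walk E xs \<longleftrightarrow> tbc_walk E xs \<and> balanced (steps xs)"
  by (simp add: zp_tbc_walk_def balanced_def)

definition segment :: "'a list \<Rightarrow> nat \<Rightarrow> nat \<Rightarrow> 'a list" where
  "segment xs i j = take (j - i) (drop i xs)"

lemma length_segment [simp]: "j \<le> length xs \<Longrightarrow> length (segment xs i j) = j - i"
  by (simp add: segment_def)

lemma nth_segment: "s < j - i \<Longrightarrow> j \<le> length xs \<Longrightarrow> segment xs i j ! s = xs ! (i + s)"
  by (simp add: segment_def)

text \<open>The closing step of the segment returns to \<open>xs ! i\<close>, which is
  \<open>xs ! j\<close>, so it is the step that the whole walk makes at position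
  \<open>j - 1\<close>.\<close>

lemma steps_segment:
  assumes "i < j" "j < length xs" "xs ! i = xs ! j"
  shows "steps (segment xs i j) = segment (steps xs) i j"
proof (rule nth_equalityI)
  fix s assume "s < length (steps (segment xs i j))"
  with assms have s: "s < j - i" by simp
  show "steps (segment xs i j) ! s = segment (steps xs) i j ! s"
  proof (cases "Suc s < j - i")
    case True
    with s assms show ?thesis by (simp add: nth_steps nth_segment)
  next
    case False
    with s have "j = Suc (i + s)" by simp
    with s assms show ?thesis by (simp add: nth_steps nth_segment)
  qed
qed (use assms in simp)

lemma tbc_subwalk_segment:
  assumes "i < j" "j < length xs" "xs ! i = xs ! j" "tbc_walk E (segment xs i j)"
  shows "tbc_subwalk E (segment xs i j) xs"
proof -
  have "rotate i (steps xs) = drop i (steps xs) @ take i (steps xs)"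
    using assms by (simp add: rotate_drop_take)
  also have "drop i (steps xs) = segment (steps xs) i j @ drop j (steps xs)"
    using assms(1) append_take_drop_id[of "j - i" "drop i (steps xs)"] by (simp add: segment_def)
  finally have "rotate i (steps xs) = steps (segment xs i j) @ drop j (steps xs) @ take i (steps xs)"
    by (simp add: steps_segment assms)
  moreover have "drop j (steps xs) \<noteq> []" using assms by simp
  ultimately show ?thesis
    using assms(4) unfolding tbc_subwalk_def by blast
qed

lemma segment_split:
  assumes "i < j" "Suc i < j" "j \<le> length xs"
  shows "segment xs i j = xs ! i # segment xs (Suc i) (j - 1) @ [xs ! (j - 1)]"
proof (rule nth_equalityI)
  show "length (segment xs i j) = length (xs ! i # segment xs (Suc i) (j - 1) @ [xs ! (j - 1)])"
    using assms by simp
  fix s assume "s < length (segment xs i j)"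
  with assms have s: "s < j - i" by simp
  consider "s = 0" | r where "s = Suc r" "Suc s < j - i" | r where "s = Suc r" "Suc s = j - i"
    using s by (cases s) force+
  then show "segment xs i j ! s = (xs ! i # segment xs (Suc i) (j - 1) @ [xs ! (j - 1)]) ! s"
  proof cases
    case (2 r)
    then have "r < j - 1 - Suc i" by simp
    with 2 s assms show ?thesis by (simp add: nth_segment nth_append)
  next
    case (3 r)
    then have "j - 1 = i + s" "r = j - 1 - Suc i" by simp_all
    with 3 s assms show ?thesis by (simp add: nth_segment nth_append)
  qed (use s assms in \<open>simp add: nth_segment\<close>)
qed

text \<open>Stripping the tail of a closed balanced segment leaves it balanced, so the
  stripping ends in a zero-permutation TBC subwalk.\<close>

lemma has_zp_tbc_subwalkI:
  assumes loopless: "\<And>a. {a} \<notin> E" and tbc: "tbc_walk E xs"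
  shows "i < j \<Longrightarrow> j < length xs \<Longrightarrow> xs ! i = xs ! j \<Longrightarrow> balanced (segment (steps xs) i j) \<Longrightarrow>
    has_zp_tbc_subwalk E xs"
proof (induction "j - i" arbitrary: i j rule: less_induct)
  case less
  note walk = tbc[unfolded tbc_walk_iff[OF loopless]]
  have edge: "{xs ! s, xs ! Suc s} \<in> E" if "Suc s < length xs" for s
    using walk[THEN conjunct2, rule_format, of s] that by simp
  have backtrack: "xs ! s \<noteq> xs ! Suc (Suc s)" if "Suc (Suc s) < length xs" for s
    using walk[THEN conjunct2, rule_format, of s] that by simp
  have adj: "xs ! s \<noteq> xs ! Suc s" if "Suc s < length xs" for s
    using edge[OF that] loopless by (metis insert_absorb2)
  show ?case
  proof (cases "xs ! Suc i = xs ! (j - 1)")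
    \<comment> \<open>The first and last edges differ, so the segment has no tail and is itself the
      wanted subwalk.\<close>
    case False
    let ?ys = "segment xs i j"
    have len: "length ?ys = j - i" using less.prems by simp
    have ji: "Suc i \<noteq> j" using adj[of i] less.prems by auto
    have "tbc_walk E ?ys"
      unfolding tbc_walk_iff[OF loopless]
    proof (intro conjI allI impI)
      show "?ys \<noteq> []" using len less.prems by force
      fix s assume "s < length ?ys"
      with len have s: "s < j - i" by simp
      show "{?ys ! s, ?ys ! (Suc s mod length ?ys)} \<in> E"
      proof (cases "Suc s < j - i")
        case True
        then show ?thesis using s len edge[of "i + s"] less.prems by (simp add: nth_segment)
      next
        case False
        with s have "Suc s = j - i" by simp
        moreover from this s have "j = Suc (i + s)" by simp
        ultimately show ?thesis
          using s len edge[of "i + s"] less.prems by (simp add: nth_segment)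
      qed
      show "?ys ! s \<noteq> ?ys ! (Suc (Suc s) mod length ?ys)"
      proof -
        consider "Suc (Suc s) < j - i" | "Suc (Suc s) = j - i" | "Suc s = j - i" using s by linarith
        then show ?thesis
        proof cases
          case 1
          then show ?thesis using s len backtrack[of "i + s"] less.prems by (simp add: nth_segment)
        next
          case 2
          then have "j = Suc (Suc (i + s))" by simp
          then show ?thesis
            using 2 s len backtrack[of "i + s"] less.prems by (simp add: nth_segment)
        next
          \<comment> \<open>This turn, from the last edge of the segment into its first, is the only
            one not inherited from \<open>xs\<close>; the case assumption excludes a tail
            here.\<close>
          case 3
          then have j: "j - 1 = i + s" by simp
          have "1 < j - i" using ji less.prems by simp
          with 3 have "Suc (Suc s) mod (j - i) = 1" by (metis mod_Suc_eq mod_self mod_less One_nat_def)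
          moreover have "?ys ! s = xs ! (j - 1)"
            unfolding j by (rule nth_segment) (use s less.prems in auto)
          moreover have "?ys ! 1 = xs ! Suc i"
            using nth_segment[of 1 j i xs] less.prems \<open>1 < j - i\<close> by simp
          ultimately show ?thesis
            using len False by simp
        qed
      qed
    qed
    with less.prems show ?thesis
      unfolding has_zp_tbc_subwalk_def zp_tbc_walk_balanced
      by (intro exI[of _ ?ys]) (simp add: steps_segment tbc_subwalk_segment)
  next
    \<comment> \<open>The segment begins and ends with opposite steps. Dropping both lowers the
      counts of the two directions of one edge equally, so balance survives.\<close>
    case True
    have ne1: "j \<noteq> Suc i" using adj[of i] less.prems by auto
    \<comment> \<open>These two steps alone would be a backtrack, so the shortened segment is
      nonempty and the induction hypothesis applies.\<close>
    have ne2: "j \<noteq> Suc (Suc i)" using backtrack[of i] less.prems by auto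
    have lt: "Suc i < j - 1" using less.prems(1) ne1 ne2 by simp
    let ?t = "segment (steps xs) (Suc i) (j - 1)"
    have "steps xs ! i = (xs ! i, xs ! Suc i)"
      using less.prems by (simp add: nth_steps)
    moreover have "steps xs ! (j - 1) = (xs ! Suc i, xs ! i)"
      using less.prems True by (simp add: nth_steps)
    ultimately have "segment (steps xs) i j =
        (xs ! i, xs ! Suc i) # ?t @ [(xs ! Suc i, xs ! i)]"
      using segment_split[of i j "steps xs"] lt less.prems by simp
    then have cnt: "count_list (segment (steps xs) i j) s = count_list ?t s +
        (if s = (xs ! i, xs ! Suc i) then 1 else 0) + (if s = (xs ! Suc i, xs ! i) then 1 else 0)" for s
      by simp
    have "balanced ?t"
      unfolding balanced_def
    proof (intro allI)
      fix u v
      show "count_list ?t (u, v) = count_list ?t (v, u)"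
        using balancedD[OF less.prems(4), of u v] unfolding cnt by (simp add: conj_commute)
    qed
    with less.hyps[of "j - 1" "Suc i"] lt less.prems True show ?thesis by simp
  qed
qed

lemma tbc_walk_reversal_neq:
  assumes loopless: "\<And>a. {a} \<notin> E" and "tbc_walk E xs"
  shows "rotate k (rev xs) \<noteq> xs"
proof (rule reversal_neq_rotate)
  note walk = assms(2)[unfolded tbc_walk_iff[OF loopless]]
  show loop: "xs ! i \<noteq> xs ! (Suc i mod length xs)" if "i < length xs" for i
    using walk that loopless by (metis insert_absorb2)
  show "xs ! i \<noteq> xs ! (Suc (Suc i) mod length xs)" if "i < length xs" for i
    using walk that by blast
  show "2 \<le> length xs"
  proof (rule ccontr)
    assume "\<not> 2 \<le> length xs"
    with walk have "length xs = 1" by (cases xs) (auto simp: Suc_le_eq)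
    with loop[of 0] show False by simp
  qed
qed

text \<open>A rotational symmetry makes the list of steps a proper power of some list
  \<open>zs\<close>. All counts are then the same multiple of those of \<open>zs\<close>, so
  \<open>zs\<close> is balanced as well; being a closed proper segment, it contradicts
  primality.\<close>

lemma prime_zp_tbc_walk_rotate_neq:
  assumes loopless: "\<And>a. {a} \<notin> E" and prime: "prime_zp_tbc_walk E xs" and k: "0 < k" "k < length xs"
  shows "rotate k xs \<noteq> xs"
proof
  assume "rotate k xs = xs"
  then have "rotate k (steps xs) = steps xs" by (metis steps_rotate)
  \<comment> \<open>Two nonempty words that commute are powers of a common word.\<close>
  then have "drop k (steps xs) @ take k (steps xs) = take k (steps xs) @ drop k (steps xs)"
    using k by (simp add: rotate_drop_take)
  moreover have "take k (steps xs) \<noteq> []" "drop k (steps xs) \<noteq> []"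
    using k by auto
  ultimately have
    "\<exists>n zs. n > 1 \<and> concat (replicate n zs) = take k (steps xs) @ drop k (steps xs)"
    by (intro comm_append_is_replicate) simp_all
  then obtain n zs where n: "n > 1" "concat (replicate n zs) = steps xs"
    by auto
  have "xs \<noteq> []" using k by auto
  then have zs: "zs \<noteq> []"
    using arg_cong[OF n(2), of length] by auto
  obtain m where m: "n = Suc (Suc m)" using n(1) that[of "n - 2"] by simp
  have eq: "steps xs = zs @ zs @ concat (replicate m zs)" using n(2) by (simp add: m)
  define g where "g = length zs"
  have g: "0 < g" "g < length xs"
    using zs arg_cong[OF eq, of length] by (auto simp: g_def)
  \<comment> \<open>Equal steps at positions \<open>0\<close> and \<open>g\<close> start at the same
    node, so the first block is closed.\<close>
  have "steps xs ! 0 = steps xs ! g" using zs by (simp add: eq g_def nth_append)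
  moreover have "steps xs ! 0 = (xs ! 0, xs ! (Suc 0 mod length xs))"
    using g by (intro nth_steps) linarith
  ultimately have closed: "xs ! 0 = xs ! g" using nth_steps[OF g(2)] by simp
  have seg: "segment (steps xs) 0 g = zs" by (simp add: segment_def eq g_def)
  have count: "count_list (concat (replicate q zs)) s = q * count_list zs s" for q s
    by (induction q) simp_all
  have "balanced zs"
    unfolding balanced_def
  proof (intro allI)
    fix u v
    have "balanced (steps xs)"
      using prime by (simp add: prime_zp_tbc_walk_def zp_tbc_walk_balanced)
    from balancedD[OF this, of u v] n(1) show "count_list zs (u, v) = count_list zs (v, u)"
      by (simp add: count flip: n(2))
  qed
  then have "has_zp_tbc_subwalk E xs"
    using has_zp_tbc_subwalkI[OF loopless, of xs 0 g] g closed seg prime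
    by (simp add: prime_zp_tbc_walk_def zp_tbc_walk_def)
  with prime show False by (simp add: prime_zp_tbc_walk_def)
qed

section \<open>The two colours of a bipartite graph, finiteness, and repeated steps\<close>

lemma bipartite_graph_edgeD:
  assumes "bipartite_graph U W E" "{a, b} \<in> E"
  shows "a \<in> U \<and> b \<in> W \<and> a \<notin> W \<and> b \<notin> U \<or> b \<in> U \<and> a \<in> W \<and> b \<notin> W \<and> a \<notin> U"
proof -
  have "{a, b} \<in> {{u, w} |u w. u \<in> U \<and> w \<in> W}"
    using assms unfolding bipartite_graph_def by blast
  then obtain u w where "{a, b} = {u, w}" "u \<in> U" "w \<in> W"
    by blast
  moreover have "U \<inter> W = {}" using assms by (simp add: bipartite_graph_def)
  ultimately show ?thesis by (auto simp: doubleton_eq_iff)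
qed

lemma bipartite_graph_loopless: "bipartite_graph U W E \<Longrightarrow> {a} \<notin> E"
  using bipartite_graph_edgeD[of U W E a a] by auto

lemma finite_bipartite_edges:
  assumes "bipartite_graph U W E"
  shows "finite E"
proof (rule finite_subset)
  show "E \<subseteq> Pow (U \<union> W)" using assms by (auto simp: bipartite_graph_def)
qed (use assms in \<open>simp add: bipartite_graph_def\<close>)

lemma finite_closed_walks:
  assumes "bipartite_graph U W E"
  shows "finite {xs. closed_walk E xs \<and> length xs = c}"
proof (rule finite_subset)
  show "{xs. closed_walk E xs \<and> length xs = c} \<subseteq> {xs. set xs \<subseteq> U \<union> W \<and> length xs = c}"
    using bipartite_graph_edgeD[OF assms]
    by (fastforce simp: closed_walk_iff in_set_conv_nth)
  show "finite {xs. set xs \<subseteq> U \<union> W \<and> length xs = c}"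
    using assms by (intro finite_lists_length_eq) (simp add: bipartite_graph_def)
qed

lemma mod_add_right_cancel_nat:
  fixes i j k n :: nat
  assumes "(i + k) mod n = (j + k) mod n"
  shows "i mod n = j mod n"
proof -
  have "int (i + k) mod int n = int (j + k) mod int n"
    using assms by (metis zmod_int)
  then have "int n dvd int i - int j"
    by (simp add: mod_eq_dvd_iff)
  then have "int i mod int n = int j mod int n"
    by (simp only: mod_eq_dvd_iff)
  then show ?thesis by (metis zmod_int of_nat_eq_iff)
qed

text \<open>If \<open>S\<close> is the set of positions where the step \<open>(u, v)\<close> is made, then the cyclic
  shifts of \<open>S\<close> by \<open>0, 1, 2, 3\<close> are disjoint: the colours of the nodes separate even
  from odd shifts, and the absence of backtracking separates the others.\<close>

lemma four_count_steps_le: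
  assumes bip: "bipartite_graph U W E" and tbc: "tbc_walk E xs"
  shows "4 * count_list (steps xs) (u, v) \<le> length xs"
proof -
  define n where "n = length xs"
  \<comment> \<open>Reading the nodes periodically removes the wrap-around from the facts on edges,
    backtracking and colours.\<close>
  define x where "x i = xs ! (i mod n)" for i
  note loopless = bipartite_graph_loopless[OF bip]
  note walk = tbc[unfolded tbc_walk_iff[OF loopless]]
  have n: "0 < n" using walk by (simp add: n_def)
  have edge: "{x i, x (Suc i)} \<in> E" and backtrack: "x i \<noteq> x (Suc (Suc i))" for i
    using walk[THEN conjunct2, rule_format, of "i mod n"] n
    by (simp_all add: x_def mod_Suc_eq mod_Suc_Suc_eq flip: n_def)
  have colour: "x (Suc i) \<in> U \<longleftrightarrow> x i \<notin> U" for i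
    using bipartite_graph_edgeD[OF bip edge[of i]] by blast
  define S where "S = {i. i < n \<and> x i = u \<and> x (Suc i) = v}"
  have S: "count_list (steps xs) (u, v) = card S"
  proof -
    have "count_list (steps xs) (u, v) = card {i. i < n \<and> steps xs ! i = (u, v)}"
      by (simp add: count_list_eq_length_filter length_filter_conv_card n_def eq_commute[of "(u, v)"])
    also have "{i. i < n \<and> steps xs ! i = (u, v)} = S"
      by (auto simp: S_def n_def nth_steps x_def)
    finally show ?thesis .
  qed
  define sh where "sh k i = (i + k) mod n" for k i
  have inj: "inj_on (sh k) S" for k
  proof (rule inj_onI)
    fix i j assume "i \<in> S" "j \<in> S" "sh k i = sh k j"
    then have "i mod n = j mod n"
      using mod_add_right_cancel_nat[of i k n j] by (simp add: sh_def)
    with \<open>i \<in> S\<close> \<open>j \<in> S\<close> show "i = j" by (simp add: S_def)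
  qed
  have disj: "sh k ` S \<inter> sh l ` S = {}" if kl: "k < l" "l < 4" for k l
  proof (rule ccontr)
    assume "sh k ` S \<inter> sh l ` S \<noteq> {}"
    then obtain i j where ij: "i \<in> S" "j \<in> S" "sh k i = sh l j" by auto
    have "(i + k) mod n = (j + (l - k) + k) mod n"
      using ij(3) kl by (simp add: sh_def)
    then have "i mod n = (j + (l - k)) mod n"
      by (rule mod_add_right_cancel_nat)
    then have "x i = x (j + (l - k))" "x (Suc i) = x (Suc (j + (l - k)))"
      unfolding x_def by (simp, metis mod_Suc_eq)
    moreover have "x i = u" "x j = u" "x (Suc i) = v" "x (Suc j) = v"
      using ij by (simp_all add: S_def)
    moreover have "l - k \<in> {1, 2, 3}" using kl by auto
    ultimately show False
      using colour[of j] colour[of "j + 1"] colour[of "j + 2"] backtrack[of j]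
        backtrack[of "j + 1"] 
      by (auto simp: numeral_3_eq_3 numeral_2_eq_2)
  qed
  have "card (\<Union>k\<in>{..<4}. sh k ` S) = (\<Sum>k\<in>{..<4::nat}. card (sh k ` S))"
  proof (rule card_UN_disjoint)
    show "\<forall>k\<in>{..<4}. finite (sh k ` S)" by (simp add: S_def)
    show "\<forall>k\<in>{..<4}. \<forall>l\<in>{..<4}. k \<noteq> l \<longrightarrow> sh k ` S \<inter> sh l ` S = {}"
      using disj by (metis Int_commute lessThan_iff linorder_neqE_nat)
  qed simp
  also have "\<dots> = 4 * card S" by (simp add: card_image inj)
  finally have "4 * card S = card (\<Union>k\<in>{..<4::nat}. sh k ` S)" ..
  also have "\<dots> \<le> card {..<n}"
    using n by (intro card_mono) (auto simp: sh_def)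
  finally show ?thesis by (simp add: S n_def)
qed

section \<open>Cycles in a cyclic lift\<close>

text \<open>The sign orients every edge from \<open>U\<close> to \<open>W\<close>. Integers are used
  instead of residues so that opposite traversals cancel exactly, whatever \<open>N\<close>
  is.\<close>

definition shift :: "'a set \<Rightarrow> ('a set \<Rightarrow> nat) \<Rightarrow> 'a \<times> 'a \<Rightarrow> int" where
  "shift U p = (\<lambda>(a, b). if a \<in> U then int (p {a, b}) else - int (p {a, b}))"

definition total_shift :: "'a set \<Rightarrow> ('a set \<Rightarrow> nat) \<Rightarrow> ('a \<times> 'a) list \<Rightarrow> int" where
  "total_shift U p ss = sum_list (map (shift U p) ss)"

text \<open>By \<open>bij_betw_lift_walk\<close> below, a TBC walk of the base graph is liftable if and only if
  it is the projection of a cycle of the lift.\<close>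

definition liftable :: "nat \<Rightarrow> 'a set \<Rightarrow> ('a set \<Rightarrow> nat) \<Rightarrow> 'a list \<Rightarrow> bool" where
  "liftable N U p xs \<longleftrightarrow> int N dvd total_shift U p (steps xs) \<and>
     (\<forall>i j. i < j \<longrightarrow> j < length xs \<longrightarrow> xs ! i = xs ! j \<longrightarrow>
       \<not> int N dvd total_shift U p (segment (steps xs) i j))"

text \<open>The index \<open>j = length xs\<close> is meaningful: the node wraps around while the
  full shift is added, so the lift closes up exactly when this node agrees with the one at
  \<open>0\<close>.\<close>

definition lift_node :: "nat \<Rightarrow> 'a set \<Rightarrow> ('a set \<Rightarrow> nat) \<Rightarrow> 'a list \<Rightarrow> nat \<Rightarrow> nat \<Rightarrow> 'a \<times> nat" where
  "lift_node N U p xs i j =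
     (xs ! (j mod length xs), nat ((int i + total_shift U p (take j (steps xs))) mod int N))"

definition lift_walk :: "nat \<Rightarrow> 'a set \<Rightarrow> ('a set \<Rightarrow> nat) \<Rightarrow> 'a list \<Rightarrow> nat \<Rightarrow> ('a \<times> nat) list" where
  "lift_walk N U p xs i = map (lift_node N U p xs i) [0..<length xs]"

section \<open>Total shifts of step lists\<close>

lemma total_shift_append [simp]:
  "total_shift U p (ss @ ts) = total_shift U p ss + total_shift U p ts"
  by (simp add: total_shift_def)

lemma total_shift_take_Suc:
  "j < length xs \<Longrightarrow> total_shift U p (take (Suc j) (steps xs)) =
     total_shift U p (take j (steps xs)) + shift U p (xs ! j, xs ! (Suc j mod length xs))"
  by (simp add: take_Suc_conv_app_nth nth_steps) (simp add: total_shift_def)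

lemma total_shift_segment:
  "i \<le> j \<Longrightarrow> total_shift U p (segment ss i j) =
     total_shift U p (take j ss) - total_shift U p (take i ss)"
  using take_add[of i "j - i" ss] by (simp add: segment_def)

lemma shift_swap:
  assumes "bipartite_graph U W E" "{a, b} \<in> E"
  shows "shift U p (b, a) = - shift U p (a, b)"
  using bipartite_graph_edgeD[OF assms] by (auto simp: shift_def insert_commute)

text \<open>Exchanging the ends of all steps permutes a balanced list and negates each shift, so the
  total equals its own negative. The negation relies on the steps being edges, with exactly one end
  in \<open>U\<close>.\<close>

lemma total_shift_balanced:
  assumes bip: "bipartite_graph U W E" and "balanced ss" and "\<And>a b. (a, b) \<in> set ss \<Longrightarrow> {a, b} \<in> E"
  shows "total_shift U p ss = 0"
proof -
  have count_swap: "count_list (map prod.swap ss) (a, b) = count_list ss (b, a)" for a b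
    using count_list_map_conv[OF inj_swap, of ss "(b, a)"] by simp
  have "mset (map prod.swap ss) = mset ss"
  proof (rule multiset_eqI)
    fix s :: "'a \<times> 'a"
    obtain a b where s: "s = (a, b)" by (cases s)
    show "count (mset (map prod.swap ss)) s = count (mset ss) s"
      using count_swap[of a b] balancedD[OF assms(2), of a b]
      by (simp add: s count_mset count_list_eq_length_filter del: mset_map)
  qed
  then have "image_mset (shift U p) (mset (map prod.swap ss)) = image_mset (shift U p) (mset ss)"
    by (simp only:)
  then have "mset (map (shift U p) (map prod.swap ss)) = mset (map (shift U p) ss)"
    by (simp only: mset_map)
  then have "sum_list (map (shift U p) (map prod.swap ss)) = total_shift U p ss"
    unfolding total_shift_def by (metis sum_mset_sum_list)
  moreover have "sum_list (map (shift U p) (map prod.swap ss)) =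
      sum_list (map (\<lambda>s. - shift U p s) ss)"
    unfolding map_map
    by (intro arg_cong[of _ _ sum_list] map_cong refl) (auto simp: shift_swap[OF bip] assms(3))
  moreover have "sum_list (map (\<lambda>s. - shift U p s) ss) = - total_shift U p ss"
    by (simp add: total_shift_def uminus_sum_list_map comp_def)
  ultimately show ?thesis by simp
qed

lemma steps_edges: "closed_walk E xs \<Longrightarrow> (a, b) \<in> set (steps xs) \<Longrightarrow> {a, b} \<in> E"
  by (force simp: closed_walk_def edge_seq_def)

text \<open>The sign in \<open>shift\<close> lets one equation cover both directions of travel. Thus
  the next copy index of a walk in the lift is a function of the current one and the step
  below.\<close>

lemma cyclic_lift_edge_iff:
  assumes bip: "bipartite_graph U W E" and N: "0 < N"
  shows "{(a, i), (b, j)} \<in> cyclic_lift N U W E p \<longleftrightarrow>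
    {a, b} \<in> E \<and> i < N \<and> j < N \<and> int j = (int i + shift U p (a, b)) mod int N"
    (is "?L \<longleftrightarrow> ?R")
proof
  \<comment> \<open>This reads the edge from \<open>W\<close> to \<open>U\<close>: subtracting the
    shift recovers the copy index it started from.\<close>
  have undo: "int k = (int ((k + m) mod N) - int m) mod int N" if "k < N" for k m :: nat
    using that by (simp add: zmod_int mod_simps)
  assume ?L
  then obtain u w k where e: "{(a, i), (b, j)} = {(u, k), (w, (k + p {u, w}) mod N)}"
    and uw: "u \<in> U" "w \<in> W" "{u, w} \<in> E" "k < N"
    unfolding cyclic_lift_def by blast
  have w: "w \<notin> U" using bip uw by (auto simp: bipartite_graph_def)
  from e consider "a = u" "i = k" "b = w" "j = (k + p {u, w}) mod N"
    | "a = w" "i = (k + p {u, w}) mod N" "b = u" "j = k"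
    by (auto simp: doubleton_eq_iff)
  then show ?R
  proof cases
    case 1
    with uw N show ?thesis by (simp add: shift_def zmod_int)
  next
    case 2
    with uw N w undo[of k "p {u, w}"] show ?thesis
      by (simp add: shift_def insert_commute)
  qed
next
  assume R: ?R
  from bipartite_graph_edgeD[OF bip, of a b] R
  consider "a \<in> U" "b \<in> W" | "b \<in> U" "a \<in> W" "a \<notin> U" by blast
  then show ?L
  proof cases
    case 1
    with R have "int j = int ((i + p {a, b}) mod N)" by (simp add: shift_def zmod_int)
    then have "j = (i + p {a, b}) mod N" by (simp only: of_nat_eq_iff)
    with 1 R show ?thesis unfolding cyclic_lift_def by blast
  next
    case 2
    with R have "int j = (int i - int (p {b, a})) mod int N"
      by (simp add: shift_def insert_commute)
    then have "int ((j + p {b, a}) mod N) = int i"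
      using R by (simp add: zmod_int mod_simps)
    then have "i = (j + p {b, a}) mod N" by linarith
    moreover have "{(a, i), (b, j)} = {(b, j), (a, i)}" "{b, a} \<in> E"
      using R by (simp_all add: insert_commute)
    ultimately show ?thesis using 2 R unfolding cyclic_lift_def by blast
  qed
qed

section \<open>Lifting walks and projecting cycles\<close>

lemma length_lift_walk [simp]: "length (lift_walk N U p xs i) = length xs"
  by (simp add: lift_walk_def)

lemma nth_lift_walk: "j < length xs \<Longrightarrow> lift_walk N U p xs i ! j = lift_node N U p xs i j"
  by (simp add: lift_walk_def)

lemma map_fst_lift_walk: "map fst (lift_walk N U p xs i) = xs"
  by (rule nth_equalityI) (simp_all add: nth_lift_walk lift_node_def)

lemma snd_hd_lift_walk: "xs \<noteq> [] \<Longrightarrow> i < N \<Longrightarrow> snd (lift_walk N U p xs i ! 0) = i"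
  by (simp add: nth_lift_walk lift_node_def total_shift_def)

text \<open>The copy indices at the two positions differ, modulo \<open>N\<close>, by the shift
  accumulated between them.\<close>

lemma lift_node_eq_iff:
  assumes "0 < N" "i < j" "j < length xs"
  shows "lift_node N U p xs k i = lift_node N U p xs k j \<longleftrightarrow>
    xs ! i = xs ! j \<and> int N dvd total_shift U p (segment (steps xs) i j)"
proof -
  let ?h = "\<lambda>j. total_shift U p (take j (steps xs))"
  have "(int k + ?h i) mod int N = (int k + ?h j) mod int N \<longleftrightarrow> int N dvd ?h j - ?h i"
    by (subst eq_commute) (simp add: mod_eq_dvd_iff)
  then show ?thesis
    using assms by (simp add: lift_node_def total_shift_segment eq_nat_nat_iff)
qed

lemma is_cycle_lift_walk:
  assumes bip: "bipartite_graph U W E" and N: "0 < N"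
    and walk: "closed_walk E xs" "3 \<le> length xs" and lift: "liftable N U p xs"
  shows "is_cycle (cyclic_lift N U W E p) (lift_walk N U p xs i)"
proof -
  let ?l = "lift_node N U p xs i" and ?n = "length xs"
  \<comment> \<open>Divisibility of the total shift is used here: it brings the lift back to its
    starting copy.\<close>
  have wrap: "?l (j mod ?n) = ?l j" if "j \<le> ?n" for j
  proof (cases "j < ?n")
    case False
    with that have j: "j = ?n" by simp
    have "int N dvd total_shift U p (steps xs)"
      using lift by (simp add: liftable_def)
    then obtain d where "total_shift U p (steps xs) = int N * d" by (rule dvdE)
    with j show ?thesis by (simp add: lift_node_def total_shift_def)
  qed simp
  have edge: "{?l j, ?l (Suc j)} \<in> cyclic_lift N U W E p" if j: "j < ?n" for j
  proof -
    have "{xs ! j, xs ! (Suc j mod ?n)} \<in> E"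
      using walk(1) j by (simp add: closed_walk_iff)
    then show ?thesis
      unfolding lift_node_def
      using N j by (simp add: cyclic_lift_edge_iff[OF bip N] nat_less_iff total_shift_take_Suc mod_simps add.assoc)
  qed
  have "closed_walk (cyclic_lift N U W E p) (lift_walk N U p xs i)"
    unfolding closed_walk_iff
  proof (intro conjI allI impI)
    show "lift_walk N U p xs i \<noteq> []" using walk(2) by (auto simp: lift_walk_def)
    fix j assume "j < length (lift_walk N U p xs i)"
    then have j: "j < ?n" by simp
    then have "Suc j mod ?n < ?n" by (intro mod_less_divisor) linarith
    with j edge[OF j] wrap[of "Suc j"]
    show "{lift_walk N U p xs i ! j, lift_walk N U p xs i ! (Suc j mod length (lift_walk N U p xs i))}
        \<in> cyclic_lift N U W E p"
      by (simp add: nth_lift_walk)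
  qed
  moreover have "distinct (lift_walk N U p xs i)"
    unfolding lift_walk_def distinct_map
  proof (intro conjI linorder_inj_onI')
    fix j k assume "j \<in> set [0..<?n]" "k \<in> set [0..<?n]" "j < k"
    then show "?l j \<noteq> ?l k"
      using lift lift_node_eq_iff[OF N, of j k xs U p i] by (auto simp: liftable_def)
  qed simp
  ultimately show ?thesis using walk(2) by (simp add: is_cycle_def)
qed

text \<open>Along a cycle every copy index is forced by the first one and the accumulated shifts, so
  the cycle is the lift of its projection. Its closing up and the distinctness of its nodes give the
  two halves of liftability.\<close>

lemma
  assumes bip: "bipartite_graph U W E" and N: "0 < N"
    and cyc: "is_cycle (cyclic_lift N U W E p) ys"
  shows lift_walk_of_cycle: "lift_walk N U p (map fst ys) (snd (ys ! 0)) = ys"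
    and tbc_walk_of_cycle: "tbc_walk E (map fst ys)"
    and liftable_of_cycle: "liftable N U p (map fst ys)"
    and snd_of_cycle: "snd (ys ! 0) < N"
proof -
  define xs i n where "xs = map fst ys" and "i = snd (ys ! 0)" and "n = length ys"
  have n: "3 \<le> n" and dist: "distinct ys" and len: "length xs = n"
    using cyc by (simp_all add: is_cycle_def n_def xs_def)
  have nths: "fst (ys ! j) = xs ! j" if "j < n" for j
    using that by (simp add: xs_def n_def)
  have edge: "{xs ! j, xs ! (Suc j mod n)} \<in> E \<and> snd (ys ! j) < N \<and>
      int (snd (ys ! (Suc j mod n))) = (int (snd (ys ! j)) + shift U p (xs ! j, xs ! (Suc j mod n))) mod int N"
    if j: "j < n" for j
  proof -
    have j': "Suc j mod n < n" using n by simp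
    have "{ys ! j, ys ! (Suc j mod n)} \<in> cyclic_lift N U W E p"
      using cyc j by (simp add: is_cycle_def closed_walk_iff n_def)
    then have "{(xs ! j, snd (ys ! j)), (xs ! (Suc j mod n), snd (ys ! (Suc j mod n)))}
        \<in> cyclic_lift N U W E p"
      using nths[OF j] nths[OF j'] by (metis prod.collapse)
    then show ?thesis by (simp add: cyclic_lift_edge_iff[OF bip N])
  qed
  show i: "snd (ys ! 0) < N" using edge[of 0] n by simp
  \<comment> \<open>The case \<open>j = n\<close> is included; comparing it with
    \<open>j = 0\<close> later gives the closing congruence.\<close>
  have height: "int (snd (ys ! (j mod n))) = (int i + total_shift U p (take j (steps xs))) mod int N"
    if "j \<le> n" for j
    using that
  proof (induction j)
    case 0
    then show ?case using i n by (simp add: total_shift_def i_def)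
  next
    case (Suc j)
    then have j: "j < n" by simp
    then show ?case
      using edge[OF j] Suc.IH
      by (simp add: len total_shift_take_Suc[of j xs U p] mod_simps add.assoc)
  qed
  have node: "lift_node N U p xs i j = ys ! j" if j: "j < n" for j
    using height[of j] nths[OF j] j by (simp add: lift_node_def len prod_eq_iff flip: height)
  show "lift_walk N U p (map fst ys) (snd (ys ! 0)) = ys"
    unfolding xs_def[symmetric] i_def[symmetric]
    by (rule nth_equalityI) (simp_all add: len n_def[symmetric] nth_lift_walk node)
  have "int N dvd total_shift U p (steps xs)"
  proof -
    have "int i mod int N = (int i + total_shift U p (steps xs)) mod int N"
      using height[of n] height[of 0] by (simp add: len total_shift_def)
    then have "(int i + total_shift U p (steps xs)) mod int N = int i mod int N" ..
    then show ?thesis by (simp add: mod_eq_dvd_iff)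
  qed
  moreover have "\<not> int N dvd total_shift U p (segment (steps xs) j k)"
    if "j < k" "k < n" "xs ! j = xs ! k" for j k
    using that lift_node_eq_iff[OF N, of j k xs U p i] node[of j] node[of k] dist
    by (simp add: len nth_eq_iff_index_eq n_def)
  ultimately show "liftable N U p (map fst ys)"
    unfolding xs_def[symmetric] by (simp add: liftable_def len)
  \<comment> \<open>A backtrack below has opposite shifts, so the cycle would return to the same
    copy after two steps, which \<open>3 \<le> n\<close> and distinctness forbid.\<close>
  have "xs ! j \<noteq> xs ! (Suc (Suc j) mod n)" if j: "j < n" for j
  proof
    assume eq: "xs ! j = xs ! (Suc (Suc j) mod n)"
    define k l where "k = Suc j mod n" and "l = Suc (Suc j) mod n"
    have kl: "k < n" "l < n" "l = Suc k mod n"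
      using n by (simp_all add: k_def l_def mod_Suc_eq)
    have "{xs ! j, xs ! k} \<in> E" using edge[OF j] by (simp add: k_def)
    then have "shift U p (xs ! k, xs ! l) = - shift U p (xs ! j, xs ! k)"
      using shift_swap[OF bip] eq by (simp add: l_def)
    then have "int (snd (ys ! l)) = int (snd (ys ! j)) mod int N"
      using edge[OF j] edge[OF kl(1)] by (simp add: mod_simps flip: k_def kl(3))
    then have "snd (ys ! l) = snd (ys ! j)"
      using edge[OF j] by simp
    then have "ys ! l = ys ! j"
      using eq nths j kl by (simp add: prod_eq_iff l_def)
    then have "l = j" using dist j kl by (simp add: nth_eq_iff_index_eq n_def)
    moreover have "l \<noteq> j" using j n by (auto simp: l_def mod_if)
    ultimately show False by simp
  qed
  moreover have "xs \<noteq> []" using len n by auto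
  ultimately show "tbc_walk E (map fst ys)"
    unfolding xs_def[symmetric] tbc_walk_iff[OF bipartite_graph_loopless[OF bip]]
    using edge by (simp add: len)
qed

text \<open>The starting copy is the only freedom that the projection leaves; the inverse map reads
  off both.\<close>

lemma bij_betw_lift_walk:
  assumes bip: "bipartite_graph U W E" and N: "0 < N" and c: "3 \<le> c"
  shows "bij_betw (\<lambda>(xs, i). lift_walk N U p xs i)
    ({xs. tbc_walk E xs \<and> length xs = c \<and> liftable N U p xs} \<times> {..<N})
    {ys. is_cycle (cyclic_lift N U W E p) ys \<and> length ys = c}"
proof (rule bij_betw_byWitness[where f' = "\<lambda>ys. (map fst ys, snd (ys ! 0))"])
  show "\<forall>a\<in>{xs. tbc_walk E xs \<and> length xs = c \<and> liftable N U p xs} \<times> {..<N}.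
      (\<lambda>ys. (map fst ys, snd (ys ! 0))) (case a of (xs, i) \<Rightarrow> lift_walk N U p xs i) = a"
    using c by (auto simp: map_fst_lift_walk intro!: snd_hd_lift_walk)
qed (use lift_walk_of_cycle[OF bip N] tbc_walk_of_cycle[OF bip N] liftable_of_cycle[OF bip N]
       snd_of_cycle[OF bip N] is_cycle_lift_walk[OF bip N] c
     in \<open>auto simp: tbc_walk_def\<close>)

section \<open>Counting the cycles of a lift\<close>

lemma is_cycle_rotate [simp]: "is_cycle E (rotate k xs) \<longleftrightarrow> is_cycle E xs"
  by (simp add: is_cycle_def)

lemma is_cycle_rev [simp]: "is_cycle E (rev xs) \<longleftrightarrow> is_cycle E xs"
  by (simp add: is_cycle_def)

lemma mod_add_neq_nat:
  fixes i d n :: nat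
  assumes "0 < d" "d < n"
  shows "(d + i) mod n \<noteq> i"
proof
  assume "(d + i) mod n = i"
  then have "(d + i) mod n = (0 + i) mod n" by (metis add_0 mod_mod_trivial)
  then have "d mod n = 0 mod n" by (rule mod_add_right_cancel_nat)
  with assms show False by simp
qed

text \<open>With distinct nodes a symmetry would identify positions; length at least 3 separates
  positions at distance two, which rules out reflections.\<close>

lemma card_walk_class_cycle:
  assumes "is_cycle E xs"
  shows "card (walk_equiv `` {xs}) = 2 * length xs"
proof (rule card_walk_class)
  have n: "3 \<le> length xs" and dist: "distinct xs"
    using assms by (simp_all add: is_cycle_def)
  show "xs \<noteq> []" using n by auto
  show "rotate k xs \<noteq> xs" if k: "0 < k" "k < length xs" for k
  proof
    assume "rotate k xs = xs"
    moreover have "0 < length xs" using k by linarith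
    ultimately have "xs ! k = xs ! 0" using nth_rotate[of 0 xs k] k by simp
    with dist k \<open>0 < length xs\<close> show False by (simp add: nth_eq_iff_index_eq del: length_greater_0_conv)
  qed
  show "rotate k (rev xs) \<noteq> xs" for k
  proof (rule reversal_neq_rotate)
    show "2 \<le> length xs" using n by simp
    fix i assume i: "i < length xs"
    have "0 < length xs" using i by linarith
    then have "Suc i mod length xs < length xs" "Suc (Suc i) mod length xs < length xs"
      by simp_all
    moreover have "Suc i mod length xs \<noteq> i" "Suc (Suc i) mod length xs \<noteq> i"
      using mod_add_neq_nat[of 1 "length xs" i] mod_add_neq_nat[of 2 "length xs" i] n by simp_all
    ultimately show "xs ! i \<noteq> xs ! (Suc i mod length xs)" "xs ! i \<noteq> xs ! (Suc (Suc i) mod length xs)"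
      using dist i by (simp_all add: nth_eq_iff_index_eq)
  qed
qed

text \<open>Double counting of cycles with a chosen start and direction: each cycle yields
  \<open>2 * c\<close> of them, and each liftable walk \<open>N\<close>, one per starting
  copy.\<close>

lemma num_cycles_cyclic_lift:
  assumes bip: "bipartite_graph U W E" and N: "0 < N" and c: "3 \<le> c"
  shows "2 * c * num_cycles c (cyclic_lift N U W E p) =
    N * card {xs. tbc_walk E xs \<and> length xs = c \<and> liftable N U p xs}"
proof -
  let ?C = "{ys. is_cycle (cyclic_lift N U W E p) ys \<and> length ys = c}"
  have "finite ?C"
    by (rule finite_subset[OF _ finite_closed_walks[OF bipartite_graph_cyclic_lift[OF bip N], of p c]])
       (auto simp: is_cycle_def)
  then have "card ?C = 2 * c * num_cycles c (cyclic_lift N U W E p)"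
    unfolding num_cycles_def by (rule card_eq_walk_classes) (auto simp: card_walk_class_cycle)
  then show ?thesis
    using bij_betw_same_card[OF bij_betw_lift_walk[OF bip N c, of p]]
    by (simp add: card_cartesian_product mult.commute[of N])
qed

section \<open>Random shifts\<close>

text \<open>The total is affine in the shift of a single edge, with the net number of its traversals
  as slope; setting that shift to 0 isolates the constant term.\<close>

lemma total_shift_upd:
  assumes "u \<in> U" "w \<notin> U"
  shows "total_shift U (f({u, w} := y)) ss =
    (int (count_list ss (u, w)) - int (count_list ss (w, u))) * int y + total_shift U (f({u, w} := 0)) ss"
proof -
  define F G where "F = f({u, w} := y)" and "G = f({u, w} := 0)"
  have shift: "shift U F s = (if s = (u, w) then int y else if s = (w, u) then - int y else 0) +
      shift U G s" for s
    using assms by (cases s) (auto simp: shift_def doubleton_eq_iff F_def G_def)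
  have "(u, w) \<noteq> (w, u)" using assms by auto
  then have "total_shift U F ss =
    (int (count_list ss (u, w)) - int (count_list ss (w, u))) * int y + total_shift U G ss"
    by (induction ss) (simp_all add: total_shift_def shift algebra_simps)
  then show ?thesis by (simp only: F_def G_def)
qed

text \<open>The values \<open>a * y + b\<close> lie in a half-open interval of length
  \<open>a * N\<close>, which contains at most \<open>a\<close> multiples of \<open>N\<close>, and
  the quotient by \<open>N\<close> determines \<open>y\<close>.\<close>

lemma card_dvd_affine_le_pos:
  fixes a b :: int
  assumes "0 < N" "0 < a"
  shows "card {y. y < N \<and> int N dvd a * int y + b} \<le> nat a"
proof -
  define S where "S = {y. y < N \<and> int N dvd a * int y + b}"
  \<comment> \<open>This is \<open>b / N\<close> rounded up, the least possible quotient.\<close>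
  define lo where "lo = - ((- b) div int N)"
  have inj: "inj_on (\<lambda>y. (a * int y + b) div int N) S"
  proof (rule inj_onI)
    fix x y assume xy: "x \<in> S" "y \<in> S" "(a * int x + b) div int N = (a * int y + b) div int N"
    have "a * int z + b = (a * int z + b) div int N * int N" if "z \<in> S" for z
      using that by (simp add: S_def)
    from this[OF xy(1)] this[OF xy(2)] xy(3) have "a * int x + b = a * int y + b"
      by (simp only:)
    with assms(2) show "x = y" by simp
  qed
  have "(\<lambda>y. (a * int y + b) div int N) ` S \<subseteq> {lo..<lo + a}"
  proof
    fix q assume "q \<in> (\<lambda>y. (a * int y + b) div int N) ` S"
    then obtain y where y: "y < N" "int N dvd a * int y + b" "q = (a * int y + b) div int N"
      by (auto simp: S_def)
    then have q: "a * int y + b = q * int N" by simp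
    have "0 \<le> a * int y" using assms by simp
    with q have "- q * int N \<le> - b" by simp
    then have "- q * int N div int N \<le> (- b) div int N"
      using assms(1) by (intro zdiv_mono1) simp_all
    moreover have "- q * int N div int N = - q"
      by (rule nonzero_mult_div_cancel_right) (use assms(1) in simp)
    ultimately have "- q \<le> (- b) div int N" by (simp only:)
    moreover have "q < lo + a"
    proof -
      have "a * int y < a * int N" using y(1) assms by simp
      with q have "(q - a) * int N < b" by (simp add: algebra_simps)
      also have "b \<le> lo * int N"
      proof -
        have "(- b) div int N * int N \<le> - b"
          using assms(1) pos_mod_sign[of "int N" "- b"] minus_mod_eq_div_mult[of "- b" "int N"]
          by linarith
        then show ?thesis by (simp add: lo_def)
      qed
      finally show ?thesis using assms(1) by (simp add: mult_less_cancel_right)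
    qed
    ultimately show "q \<in> {lo..<lo + a}" by (simp add: lo_def)
  qed
  then have "card ((\<lambda>y. (a * int y + b) div int N) ` S) \<le> card {lo..<lo + a}"
    by (intro card_mono) simp_all
  then show ?thesis by (simp add: card_image inj flip: S_def)
qed

lemma card_dvd_affine_le:
  fixes a b :: int
  assumes "0 < N" "a \<noteq> 0"
  shows "card {y. y < N \<and> int N dvd a * int y + b} \<le> nat \<bar>a\<bar>"
proof (cases "0 < a")
  case True
  then show ?thesis using card_dvd_affine_le_pos[OF assms(1), of a b] by simp
next
  case False
  have "int N dvd a * int y + b \<longleftrightarrow> int N dvd - a * int y + - b" for y
    by (metis dvd_minus_iff minus_add_distrib mult_minus_left)
  then show ?thesis
    using card_dvd_affine_le_pos[OF assms(1), of "- a" "- b"] False assms(2) by simp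
qed

abbreviation random_shifts :: "nat \<Rightarrow> 'a set set \<Rightarrow> ('a set \<Rightarrow> nat) pmf" where
  "random_shifts N E \<equiv> Pi_pmf E 0 (\<lambda>_. pmf_of_set {..<N})"

text \<open>Given the shifts of all other edges, the event is an affine congruence for the uniform
  shift of \<open>{u, w}\<close>, with at most \<bar>a\<bar> solutions. The maximum of the two
  counts bounds \<bar>a\<bar> and can be estimated one direction at a time.\<close>

lemma prob_dvd_total_shift_le:
  assumes "finite E" "{u, w} \<in> E" "u \<in> U" "w \<notin> U" "0 < N"
    and neq: "count_list ss (u, w) \<noteq> count_list ss (w, u)"
  shows "real N * measure_pmf.prob (random_shifts N E) {p. int N dvd total_shift U p ss} \<le>
    real (max (count_list ss (u, w)) (count_list ss (w, u)))"
proof -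
  define a where "a = int (count_list ss (u, w)) - int (count_list ss (w, u))"
  define X where "X = {p. int N dvd total_shift U p ss}"
  define e where "e = {u, w}"
  define r where "r = real (nat \<bar>a\<bar>) / real N"
  have a: "a \<noteq> 0" using neq by (simp add: a_def)
  have "random_shifts N E = random_shifts N (insert e (E - {e}))"
    using assms(2) by (simp add: e_def insert_absorb)
  also have "\<dots> = do {y \<leftarrow> pmf_of_set {..<N}; f \<leftarrow> random_shifts N (E - {e}); return_pmf (f(e := y))}"
    by (rule Pi_pmf_insert') (use assms(1) in auto)
  \<comment> \<open>Drawing the shift of \<open>e\<close> last makes the inner distribution the
    conditional one.\<close>
  also have "\<dots> = do {f \<leftarrow> random_shifts N (E - {e}); map_pmf (\<lambda>y. f(e := y)) (pmf_of_set {..<N})}"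
    by (subst bind_commute_pmf) (simp add: map_pmf_def)
  finally have eq: "random_shifts N E = \<dots>" .
  have mem: "f(e := y) \<in> X \<longleftrightarrow> int N dvd a * int y + total_shift U (f(e := 0)) ss" for f y
    unfolding X_def e_def a_def mem_Collect_eq
    by (subst total_shift_upd[OF assms(3,4)]) (rule refl)
  have "emeasure (map_pmf (\<lambda>y. f(e := y)) (pmf_of_set {..<N})) X \<le> ennreal r" for f
  proof -
    have "emeasure (map_pmf (\<lambda>y. f(e := y)) (pmf_of_set {..<N})) X =
        measure (pmf_of_set {..<N}) ((\<lambda>y. f(e := y)) -` X)"
      by (simp add: measure_pmf.emeasure_eq_measure)
    also have "measure (pmf_of_set {..<N}) ((\<lambda>y. f(e := y)) -` X) =
        real (card ({..<N} \<inter> (\<lambda>y. f(e := y)) -` X)) / real N"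
      using assms(5) by (subst measure_pmf_of_set) (auto simp: lessThan_empty_iff)
    also have "{..<N} \<inter> (\<lambda>y. f(e := y)) -` X =
        {y. y < N \<and> int N dvd a * int y + total_shift U (f(e := 0)) ss}"
      using mem by blast
    also have "ennreal (real (card {y. y < N \<and> int N dvd a * int y + total_shift U (f(e := 0)) ss}) / real N)
        \<le> ennreal r"
      unfolding r_def
      by (intro ennreal_leI divide_right_mono of_nat_mono card_dvd_affine_le[OF assms(5) a]) simp
    finally show ?thesis .
  qed
  then have "emeasure (random_shifts N E) X \<le> (\<integral>\<^sup>+ f. ennreal r \<partial>random_shifts N (E - {e}))"
    unfolding eq emeasure_bind_pmf by (intro nn_integral_mono)
  also have "\<dots> = ennreal r"
    by (simp add: measure_pmf.emeasure_space_1)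
  finally have "measure (random_shifts N E) X \<le> r"
    by (simp add: measure_pmf.emeasure_eq_measure r_def)
  then have "real N * measure (random_shifts N E) X \<le> real (nat \<bar>a\<bar>)"
    using assms(5) by (simp add: r_def field_simps)
  also have "\<dots> \<le> real (max (count_list ss (u, w)) (count_list ss (w, u)))"
    by (simp add: a_def)
  finally show ?thesis by (simp add: X_def)
qed

section \<open>Lifting probabilities of single walks\<close>

lemma tbc_walk_closed: "tbc_walk E xs \<Longrightarrow> closed_walk E xs"
  by (simp add: tbc_walk_def)

text \<open>Stated for any \<open>ss\<close> dominated by the steps of the walk, so that it serves
  both the whole walk and its segments.\<close>

lemma prob_dvd_unbalanced_le:
  assumes bip: "bipartite_graph U W E" and N: "0 < N" and tbc: "tbc_walk E xs"
    and sub: "\<And>s. count_list ss s \<le> count_list (steps xs) s" and unbalanced: "\<not> balanced ss"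
  shows "real N * measure_pmf.prob (random_shifts N E) {p. int N dvd total_shift U p ss} \<le>
    real (length xs) / 4"
proof -
  obtain a b where ab: "count_list ss (a, b) \<noteq> count_list ss (b, a)"
    using unbalanced by (auto simp: balanced_def)
  have edge: "{a, b} \<in> E" if "count_list ss (a, b) \<noteq> 0" for a b
  proof -
    have "count_list (steps xs) (a, b) \<noteq> 0" using that sub[of "(a, b)"] by linarith
    then have "(a, b) \<in> set (steps xs)" by (simp add: count_list_0_iff)
    then show ?thesis using steps_edges[OF tbc_walk_closed[OF tbc]] by blast
  qed
  have "{a, b} \<in> E"
    using edge[of a b] edge[of b a] ab by (metis insert_commute)
  then have E: "{a, b} \<in> E" "{b, a} \<in> E" by (simp_all add: insert_commute)
  \<comment> \<open>The unbalanced edge is oriented so that its first end lies in \<open>U\<close>,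
    as the single-edge bound requires.\<close>
  obtain u w where uw: "u \<in> U" "w \<notin> U" "{u, w} \<in> E"
      "count_list ss (u, w) \<noteq> count_list ss (w, u)"
    using bipartite_graph_edgeD[OF bip E(1)] ab that[of a b] that[of b a] E by fastforce
  have "4 * count_list ss (x, y) \<le> length xs" for x y
    using sub[of "(x, y)"] four_count_steps_le[OF bip tbc, of x y] by linarith
  from this[of u w] this[of w u]
  have "real (max (count_list ss (u, w)) (count_list ss (w, u))) \<le> real (length xs) / 4"
    by simp
  with prob_dvd_total_shift_le[OF finite_bipartite_edges[OF bip] uw(3,1,2) N uw(4)]
  show ?thesis by linarith
qed

lemma count_segment_le: "count_list (segment ss i j) s \<le> count_list ss s"
proof -
  have "count_list (take (j - i) (drop i ss)) s \<le> count_list (drop i ss) s"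
    by (metis append_take_drop_id count_list_append le_add1)
  also have "\<dots> \<le> count_list ss s"
    by (metis append_take_drop_id count_list_append le_add2)
  finally show ?thesis by (simp add: segment_def)
qed

lemma prob_liftable_le_not_zp:
  assumes bip: "bipartite_graph U W E" and N: "0 < N" and tbc: "tbc_walk E xs"
    and "\<not> zp_tbc_walk E xs"
  shows "real N * measure_pmf.prob (random_shifts N E) {p. liftable N U p xs} \<le> real (length xs) / 4"
proof -
  have "measure_pmf.prob (random_shifts N E) {p. liftable N U p xs} \<le>
      measure_pmf.prob (random_shifts N E) {p. int N dvd total_shift U p (steps xs)}"
    by (rule measure_pmf.finite_measure_mono) (auto simp: liftable_def)
  then have "real N * measure_pmf.prob (random_shifts N E) {p. liftable N U p xs} \<le>
      real N * measure_pmf.prob (random_shifts N E) {p. int N dvd total_shift U p (steps xs)}"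
    by (simp add: mult_left_mono)
  also have "\<dots> \<le> real (length xs) / 4"
    using assms by (intro prob_dvd_unbalanced_le[OF bip N tbc]) (auto simp: zp_tbc_walk_balanced)
  finally show ?thesis .
qed

lemma prob_liftable_ge_prime:
  assumes bip: "bipartite_graph U W E" and N: "0 < N" and prime: "prime_zp_tbc_walk E xs"
  shows "real N - real (length xs) ^ 3 / 4 \<le>
    real N * measure_pmf.prob (random_shifts N E) {p. liftable N U p xs}"
proof -
  let ?P = "measure_pmf.prob (random_shifts N E)" and ?n = "length xs"
  define I where "I = {(i, j). i < j \<and> j < ?n \<and> xs ! i = xs ! j}"
  define bad where "bad = (\<lambda>(i, j). {p. int N dvd total_shift U p (segment (steps xs) i j)})"
  have tbc: "tbc_walk E xs" and bal: "balanced (steps xs)" and no_sub: "\<not> has_zp_tbc_subwalk E xs"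
    using prime by (auto simp: prime_zp_tbc_walk_def zp_tbc_walk_balanced)
  have I: "I \<subseteq> {..<?n} \<times> {..<?n}" by (auto simp: I_def)
  then have fin: "finite I" by (rule finite_subset) simp
  \<comment> \<open>The closing congruence holds for every choice of shifts, so only early returns
    can prevent lifting.\<close>
  have zero: "total_shift U p (steps xs) = 0" for p
    by (rule total_shift_balanced[OF bip bal steps_edges[OF tbc_walk_closed[OF tbc]]])
  have "1 - ?P {p. liftable N U p xs} = ?P (- {p. liftable N U p xs})"
    using measure_pmf.prob_compl[of "{p. liftable N U p xs}" "random_shifts N E"]
    by (simp add: Compl_eq_Diff_UNIV)
  also have "- {p. liftable N U p xs} \<subseteq> (\<Union>ij\<in>I. bad ij)"
    by (auto simp: liftable_def zero I_def bad_def)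
  then have "?P (- {p. liftable N U p xs}) \<le> ?P (\<Union>ij\<in>I. bad ij)"
    by (rule measure_pmf.finite_measure_mono) simp
  also have "\<dots> \<le> (\<Sum>ij\<in>I. ?P (bad ij))"
    by (rule measure_pmf.finite_measure_subadditive_finite[OF fin]) simp
  finally have "real N * (1 - ?P {p. liftable N U p xs}) \<le> real N * (\<Sum>ij\<in>I. ?P (bad ij))"
    by (simp add: mult_left_mono)
  also have "\<dots> = (\<Sum>ij\<in>I. real N * ?P (bad ij))"
    by (rule sum_distrib_left)
  also have "\<dots> \<le> (\<Sum>ij\<in>I. real ?n / 4)"
  proof (rule sum_mono)
    fix ij assume "ij \<in> I"
    then obtain i j where ij: "ij = (i, j)" "i < j" "j < ?n" "xs ! i = xs ! j"
      by (auto simp: I_def)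
    have "\<not> balanced (segment (steps xs) i j)"
      using has_zp_tbc_subwalkI[OF bipartite_graph_loopless[OF bip] tbc ij(2-4)] no_sub by blast
    then show "real N * ?P (bad ij) \<le> real ?n / 4"
      unfolding bad_def ij(1) prod.case
      by (intro prob_dvd_unbalanced_le[OF bip N tbc] count_segment_le)
  qed
  also have "\<dots> = real (card I) * (real ?n / 4)" by simp
  \<comment> \<open>Pairs of positions are counted crudely by the full square; one factor
    \<open>?n / 4\<close> for each gives the cubic term.\<close>
  also have "\<dots> \<le> real (?n * ?n) * (real ?n / 4)"
  proof (intro mult_right_mono of_nat_mono)
    show "card I \<le> ?n * ?n"
      using card_mono[OF _ I] by (simp add: card_cartesian_product)
  qed simp
  also have "\<dots> = real ?n ^ 3 / 4" by (simp add: power3_eq_cube)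
  finally show ?thesis by (simp add: algebra_simps)
qed

text \<open>A cycle of the lift over a rotation of the walk would run through the
  zero-permutation subwalk first and hence return to its starting node too early.\<close>

lemma not_liftable_zp_subwalk:
  assumes bip: "bipartite_graph U W E" and N: "0 < N" and tbc: "tbc_walk E xs"
    and len: "3 \<le> length xs" and sub: "has_zp_tbc_subwalk E xs"
  shows "\<not> liftable N U p xs"
proof
  assume lift: "liftable N U p xs"
  obtain ys k rest where ys: "zp_tbc_walk E ys" "rest \<noteq> []" "rotate k (steps xs) = steps ys @ rest"
    using sub by (auto simp: has_zp_tbc_subwalk_def tbc_subwalk_def)
  define zs where "zs = rotate k xs"
  define m where "m = length ys"
  let ?cs = "lift_walk N U p xs 0"
  \<comment> \<open>Liftability is transferred to the rotated walk through the lift: a rotated cycle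
    is a cycle, and its projection is liftable.\<close>
  have "is_cycle (cyclic_lift N U W E p) (rotate k ?cs)"
    using is_cycle_lift_walk[OF bip N _ len lift, of 0] tbc by (simp add: tbc_walk_def)
  then have "liftable N U p (map fst (rotate k ?cs))"
    by (rule liftable_of_cycle[OF bip N])
  then have lift': "liftable N U p zs"
    by (simp add: zs_def map_fst_lift_walk flip: rotate_map)
  have zs: "steps zs = steps ys @ rest" by (simp add: zs_def steps_rotate ys(3))
  have m: "0 < m" "m < length zs"
  proof -
    show "0 < m" using ys(1) by (auto simp: m_def zp_tbc_walk_def tbc_walk_def closed_walk_def)
    have "length zs = m + length rest" using arg_cong[OF zs, of length] by (simp add: m_def)
    then show "m < length zs" using ys(2) by simp
  qed
  have "zs ! 0 = ys ! 0"
    using arg_cong[OF zs, of "map fst"] m by (simp add: nth_append m_def)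
  \<comment> \<open>Node \<open>m\<close> is where the last step of \<open>ys\<close> ends, which is
    the start of \<open>ys\<close>.\<close>
  moreover have "zs ! m = ys ! 0"
  proof -
    have "steps zs ! (m - 1) = (zs ! (m - 1), zs ! m)"
      using m by (simp add: nth_steps)
    moreover have "steps zs ! (m - 1) = steps ys ! (m - 1)"
      using m by (simp add: zs nth_append m_def)
    moreover have "steps ys ! (m - 1) = (ys ! (m - 1), ys ! 0)"
      using m by (simp add: nth_steps m_def)
    ultimately show ?thesis by simp
  qed
  moreover have "segment (steps zs) 0 m = steps ys"
    by (simp add: segment_def zs m_def)
  moreover have "total_shift U p (steps ys) = 0"
    using ys(1) unfolding zp_tbc_walk_balanced
    by (intro total_shift_balanced[OF bip _ steps_edges[OF tbc_walk_closed]]) blast+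
  moreover have "zs ! 0 = zs ! m \<longrightarrow> \<not> int N dvd total_shift U p (segment (steps zs) 0 m)"
    using lift' m unfolding liftable_def by blast
  ultimately show False by simp
qed

section \<open>The expected number of cycles and its bounds\<close>

lemma expectation_num_cycles:
  assumes bip: "bipartite_graph U W E" and N: "0 < N" and c: "3 \<le> c"
  shows "2 * real c * measure_pmf.expectation (random_cyclic_lift N U W E) (\<lambda>L. real (num_cycles c L)) =
    (\<Sum>xs | tbc_walk E xs \<and> length xs = c.
      real N * measure_pmf.prob (random_shifts N E) {p. liftable N U p xs})"
proof -
  let ?T = "{xs. tbc_walk E xs \<and> length xs = c}" and ?R = "random_shifts N E"
  have fin: "finite ?T"
    by (rule finite_subset[OF _ finite_closed_walks[OF bip, of c]]) (auto simp: tbc_walk_def)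
  \<comment> \<open>Counting node sequences instead of classes writes the number of cycles as a sum
    of indicators, one per walk, ready for linearity of expectation.\<close>
  have num: "2 * real c * real (num_cycles c (cyclic_lift N U W E p)) =
      (\<Sum>xs\<in>?T. real N * indicator {p. liftable N U p xs} p)" for p
  proof -
    have "2 * real c * real (num_cycles c (cyclic_lift N U W E p)) =
        real N * real (card {xs. tbc_walk E xs \<and> length xs = c \<and> liftable N U p xs})"
      using arg_cong[OF num_cycles_cyclic_lift[OF bip N c, of p], of real] by simp
    also have "{xs. tbc_walk E xs \<and> length xs = c \<and> liftable N U p xs} = {xs \<in> ?T. liftable N U p xs}"
      by blast
    also have "real (card {xs \<in> ?T. liftable N U p xs}) = (\<Sum>xs\<in>?T. indicator {p. liftable N U p xs} p)"
      using sum.inter_filter[OF fin, of "\<lambda>_. 1 :: real" "liftable N U p"]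
      by (simp add: indicator_def of_bool_def)
    finally show ?thesis by (simp add: sum_distrib_left)
  qed
  have "2 * real c * measure_pmf.expectation (random_cyclic_lift N U W E) (\<lambda>L. real (num_cycles c L)) =
      measure_pmf.expectation ?R (\<lambda>p. 2 * real c * real (num_cycles c (cyclic_lift N U W E p)))"
    by (simp add: random_cyclic_lift_def)
  also have "\<dots> = measure_pmf.expectation ?R
      (\<lambda>p. \<Sum>xs\<in>?T. real N * indicator {p. liftable N U p xs} p)"
    by (simp only: num)
  also have "\<dots> = (\<Sum>xs\<in>?T. measure_pmf.expectation ?R
      (\<lambda>p. real N * indicator {p. liftable N U p xs} p))"
    by (rule Bochner_Integration.integral_sum)
       (intro integrable_mult_right integrable_real_indicator; simp add: measure_pmf.emeasure_eq_measure)
  also have "\<dots> = (\<Sum>xs\<in>?T. real N * measure_pmf.prob ?R {p. liftable N U p xs})"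
    by simp
  finally show ?thesis .
qed

theorem theorem7:
  fixes U W :: "'a set" and E :: "'a set set" and N c :: nat
  assumes "bipartite_graph U W E" and "N \<ge> 1" and "even c" and "c \<ge> 4"
  shows "(real N - real c ^ 3 / 4) * real (card (T1_set c E))
           \<le> measure_pmf.expectation (random_cyclic_lift N U W E) (\<lambda>L. real (num_cycles c L))
       \<and> measure_pmf.expectation (random_cyclic_lift N U W E) (\<lambda>L. real (num_cycles c L))
           \<le> real N * real (card (T1_set c E)) + real c / 4 * real (card (T3_set c E))"
proof -
  note bip = assms(1) and c = assms(4)
  have N: "0 < N" and c0: "0 < c" using assms by simp_all
  let ?EX = "measure_pmf.expectation (random_cyclic_lift N U W E) (\<lambda>L. real (num_cycles c L))"
  define A1 where "A1 = {xs. prime_zp_tbc_walk E xs \<and> length xs = c}"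
  define A2 where "A2 = {xs. tbc_walk E xs \<and> has_zp_tbc_subwalk E xs \<and> length xs = c}"
  define A3 where "A3 = {xs. tbc_walk E xs \<and> \<not> zp_tbc_walk E xs \<and> \<not> has_zp_tbc_subwalk E xs \<and> length xs = c}"
  define g where "g xs = real N * measure_pmf.prob (random_shifts N E) {p. liftable N U p xs}" for xs
  have split: "{xs. tbc_walk E xs \<and> length xs = c} = A1 \<union> A2 \<union> A3"
    by (auto simp: A1_def A2_def A3_def prime_zp_tbc_walk_def zp_tbc_walk_def)
  have "finite {xs. tbc_walk E xs \<and> length xs = c}"
    by (rule finite_subset[OF _ finite_closed_walks[OF bip, of c]]) (auto simp: tbc_walk_def)
  then have fin: "finite A1" "finite A2" "finite A3" by (simp_all add: split)
  have "A1 \<inter> A2 = {}" "(A1 \<union> A2) \<inter> A3 = {}"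
    by (auto simp: A1_def A2_def A3_def prime_zp_tbc_walk_def)
  then have "2 * real c * ?EX = sum g A1 + sum g A2 + sum g A3"
    using expectation_num_cycles[OF bip N, of c] c fin
    by (simp add: split sum.union_disjoint flip: g_def)
  \<comment> \<open>Walks with a zero-permutation subwalk never lift, whatever the shifts
    are.\<close>
  moreover have "sum g A2 = 0"
    using not_liftable_zp_subwalk[OF bip N] c by (intro sum.neutral) (auto simp: A2_def g_def)
  ultimately have EX: "2 * real c * ?EX = sum g A1 + sum g A3" by simp
  \<comment> \<open>Equality is essential: this set enters both bounds, and the factor in the lower
    bound may be negative.\<close>
  have card1: "card A1 = 2 * c * card (T1_set c E)"
    unfolding T1_set_def A1_def[symmetric]
  proof (rule card_eq_walk_classes[OF fin(1)])
    note loopless = bipartite_graph_loopless[OF bip]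
    fix xs assume "xs \<in> A1"
    then have xs: "prime_zp_tbc_walk E xs" "length xs = c" by (simp_all add: A1_def)
    then have tbc: "tbc_walk E xs" by (simp add: prime_zp_tbc_walk_def zp_tbc_walk_def)
    have "card (walk_equiv `` {xs}) = 2 * length xs"
      by (rule card_walk_class)
         (use tbc_walk_reversal_neq[OF loopless tbc] prime_zp_tbc_walk_rotate_neq[OF loopless xs(1)]
            xs(2) c0 in auto)
    with xs(2) show "card (walk_equiv `` {xs}) = 2 * c" by simp
  qed (auto simp: A1_def)
  \<comment> \<open>Only the upper bound involves this set, so smaller, symmetric classes do no
    harm.\<close>
  have card3: "card A3 \<le> 2 * c * card (T3_set c E)"
  proof -
    have "card A3 \<le> 2 * c * card (A3 // walk_equiv)"
      by (rule card_le_walk_classes[OF fin(3)]) (auto simp: A3_def c0)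
    also have "card (A3 // walk_equiv) \<le> card (T3_set c E)"
    proof (rule card_mono)
      show "finite (T3_set c E)"
        using \<open>finite {xs. tbc_walk E xs \<and> length xs = c}\<close>
        by (simp add: T3_set_def tbc_classes_def quotient_def)
      \<comment> \<open>The third set is a difference of sets of classes; knowing the unions of the
        first two shows that no class in them contains a walk from \<open>A3\<close>.\<close>
      have U1: "\<Union>(T1_set c E) = A1" "\<Union>(T2_set c E) = A2"
        unfolding T1_set_def T2_set_def A1_def[symmetric] A2_def[symmetric]
        by (rule Union_walk_classes; simp add: A1_def A2_def)+
      show "A3 // walk_equiv \<subseteq> T3_set c E"
      proof
        fix C assume "C \<in> A3 // walk_equiv"
        then obtain xs where xs: "xs \<in> A3" "C = walk_equiv `` {xs}" by (auto simp: quotient_def)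
        then have "C \<in> tbc_classes c E" by (auto simp: tbc_classes_def A3_def quotient_def)
        moreover have "xs \<in> C"
          using equiv_class_self[OF equiv_walk_equiv] xs(2) by auto
        then have "C \<notin> T1_set c E \<union> T2_set c E"
          using U1 xs(1) \<open>(A1 \<union> A2) \<inter> A3 = {}\<close> by blast
        ultimately show "C \<in> T3_set c E" by (simp add: T3_set_def)
      qed
    qed
    finally show ?thesis by simp
  qed
  \<comment> \<open>Both bounds are proved for node sequences, that is multiplied by
    \<open>2 * c\<close>, and the factor is cancelled at the end.\<close>
  have "2 * real c * ((real N - real c ^ 3 / 4) * real (card (T1_set c E))) =
      (\<Sum>xs\<in>A1. real N - real c ^ 3 / 4)"
    by (simp add: card1)
  also have "\<dots> \<le> sum g A1"
    using prob_liftable_ge_prime[OF bip N] by (intro sum_mono) (auto simp: A1_def g_def)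
  also have "\<dots> \<le> sum g A1 + sum g A3"
    by (simp add: sum_nonneg g_def)
  finally have lower: "2 * real c * ((real N - real c ^ 3 / 4) * real (card (T1_set c E))) \<le>
      2 * real c * ?EX"
    by (simp only: EX)
  have "sum g A1 \<le> (\<Sum>xs\<in>A1. real N)"
    by (intro sum_mono) (simp add: g_def mult_left_le)
  moreover have "sum g A3 \<le> (\<Sum>xs\<in>A3. real c / 4)"
    using prob_liftable_le_not_zp[OF bip N] by (intro sum_mono) (auto simp: A3_def g_def)
  moreover have "real (card A3) * (real c / 4) \<le> real (2 * c * card (T3_set c E)) * (real c / 4)"
    using card3 by (intro mult_right_mono of_nat_mono) simp_all
  ultimately have "2 * real c * ?EX \<le>
      2 * real c * (real N * real (card (T1_set c E)) + real c / 4 * real (card (T3_set c E)))"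
    using EX by (simp add: card1 algebra_simps)
  moreover have "0 < 2 * real c" using c0 by simp
  ultimately show ?thesis
    using lower by (blast intro: mult_left_le_imp_le)
qed

end
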